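(* Let $s,t\ge 0$ with $s+t=1$, and let $\theta\in\mathbb{R}$ satisfy $$\inf_{q\in\mathbb{N}} q^{1/s}\|q\theta\|>0,$$ where, when $s=0$, the left-hand side is understood to be $+\infty$ (so the condition is vacuous). Then the set $\mathrm{Bad}(s,t;\theta)=\{y\in\mathbb{R}:(\theta,y)\in\mathrm{Bad}(s,t)\}$ is $\tfrac12$-winning (for Schmidt's game on $\mathbb{R}$).
   Context: For $x\in\mathbb{R}$, $\|x\|$ denotes the distance from $x$ to the nearest integer. For nonnegative $s,t$ with $s+t=1$, $\mathrm{Bad}(s,t)=\{(x_1,x_2)\in\mathbb{R}^2:\inf_{q\in\mathbb{N}}\max\{q^{s}\|qx_1\|,q^{t}\|qx_2\|\}>0\}$. Schmidt's game on a complete metric space $X$ with parameters $\alpha,\beta\in(0,1)$: Bob chooses a closed ball $B_0$; after $B_n$ is chosen, Alice chooses a closed ball $A_n\subset B_n$ of radius $\alpha$ times the radius of $B_n$, then Bob chooses a closed ball $B_{n+1}\subset A_n$ of radius $\beta$ times the radius of $A_n$. A set $Y\subset X$ is $(\alpha,\beta)$-winning if Alice has a strategy guaranteeing that the unique point of $\bigcap_n A_n$ lies in $Y$, and $\alpha$-winning if it is $(\alpha,\beta)$-winning for every $\beta\in(0,1)$. Here $X=\mathbb{R}$, so balls are compact intervals. *)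

theory Defs
  imports "HOL-Analysis.Analysis"
begin

definition dist_int :: "real \<Rightarrow> real" where
  "dist_int x = (INF k::int. \<bar>x - of_int k\<bar>)"

definition Bad :: "real \<Rightarrow> real \<Rightarrow> (real \<times> real) set" where
  "Bad s t = {(x1, x2). (INF q\<in>{1::nat..}. max (real q powr s * dist_int (real q * x1))
                                               (real q powr t * dist_int (real q * x2))) > 0}"

definition Bad_fibre :: "real \<Rightarrow> real \<Rightarrow> real \<Rightarrow> real set" where
  "Bad_fibre s t \<theta> = {y. (\<theta>, y) \<in> Bad s t}"

text \<open>Schmidt's game on the real line. A closed ball (compact interval) is encoded by
  a pair (centre, radius) with radius > 0, denoting cball centre radius.
  Alice's strategy maps the history of Bob's balls B_0,...,B_n to her ball A_n.
  Bob's play is a sequence b of balls; it is legal if B_0 has positive radius and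
  each B_(n+1) is contained in A_n with radius beta times that of A_n.
  Alice wins if, against every legal play of Bob, all her moves are legal
  (A_n contained in B_n, radius alpha times that of B_n) and every point of the
  intersection of the A_n lies in Y.\<close>
definition ball_of :: "real \<times> real \<Rightarrow> real set" where
  "ball_of B = cball (fst B) (snd B)"

definition ab_winning :: "real \<Rightarrow> real \<Rightarrow> real set \<Rightarrow> bool" where
  "ab_winning \<alpha> \<beta> Y \<longleftrightarrow>
     (\<exists>strat :: (real \<times> real) list \<Rightarrow> real \<times> real.
        \<forall>b :: nat \<Rightarrow> real \<times> real.
          (let a = (\<lambda>n. strat (map b [0..<Suc n])) in
            (snd (b 0) > 0 \<and>
             (\<forall>n. snd (b (Suc n)) = \<beta> * snd (a n) \<and> ball_of (b (Suc n)) \<subseteq> ball_of (a n)))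
            \<longrightarrow>
            ((\<forall>n. snd (a n) = \<alpha> * snd (b n) \<and> ball_of (a n) \<subseteq> ball_of (b n)) \<and>
             (\<forall>x. (\<forall>n. x \<in> ball_of (a n)) \<longrightarrow> x \<in> Y))))"

definition alpha_winning :: "real \<Rightarrow> real set \<Rightarrow> bool" where
  "alpha_winning \<alpha> Y \<longleftrightarrow> (\<forall>\<beta>. 0 < \<beta> \<and> \<beta> < 1 \<longrightarrow> ab_winning \<alpha> \<beta> Y)"

end

theory Submission
  imports Defs
begin

text \<open>A rational point \<open>(p/q, r/q)\<close> with \<open>\<bar>q \<theta> - p\<bar> q\<^sup>s < c\<close> is put on a rational line
  \<open>A X + B Y + C = 0\<close> with \<open>\<bar>A\<bar> \<le> q\<^sup>s\<close> and \<open>1 \<le> B \<le> q\<^sup>t\<close>; the hypothesis on \<open>\<theta>\<close> excludes \<open>B = 0\<close>.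
  The points \<open>y\<close> spoiled by this rational point lie within \<open>2 c / (q B)\<close> of the height of the line
  above \<open>\<theta>\<close>. Group the points by the size of \<open>q B\<close>, of order \<open>R\<^sup>n\<close>, and of \<open>q\<^sup>t / B\<close>, of order
  \<open>R\<close> to the power \<open>K + l k\<close>. If two lines of the same group had different heights and both came
  close to Bob's ball of radius \<open>\<rho> R\<close> to the power \<open>k - n\<close>, then they would meet in a rational point of
  so small a denominator that Alice has avoided it before. So every group threatens only one short
  interval inside that ball, and Alice has about \<open>k\<close> rounds to leave it. She does so by choosing
  the half of Bob's ball with the smaller weighted number of pending intervals.\<close>

section \<open>A potential strategy for Schmidt's game\<close>

text \<open>Twice the same half: Bob's intermediate ball has radius
  \<open>\<beta> / 2 * snd B\<close> and lies inside the chosen half of \<open>B\<close>, so its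
  centre, where Alice's second ball ends, keeps that distance from the centre of \<open>B\<close>.
  The two sides are therefore \<open>\<beta> * snd B\<close> apart.\<close>

definition side :: "real \<Rightarrow> bool \<Rightarrow> real \<times> real \<Rightarrow> real set" where
  "side \<beta> left B =
     (if left then {fst B - snd B .. fst B - \<beta> / 2 * snd B}
      else {fst B + \<beta> / 2 * snd B .. fst B + snd B})"

lemma ball_of_eq: "ball_of B = {fst B - snd B .. fst B + snd B}"
  by (simp add: ball_of_def cball_eq_atLeastAtMost)

lemma side_subset_ball_of:
  assumes "0 \<le> \<beta>" "\<beta> \<le> 2" "0 \<le> snd B"
  shows "side \<beta> d B \<subseteq> ball_of B"
proof -
  define m where "m = \<beta> / 2 * snd B"
  have "0 \<le> m" "m \<le> 1 * snd B"
    unfolding m_def using assms by (simp, intro mult_right_mono) auto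
  then show ?thesis unfolding side_def ball_of_eq m_def[symmetric] by auto
qed

text \<open>Alice repeats every chosen direction once: after two rounds in the same direction the
  remaining ball stays away from the centre by a definite fraction of the radius.\<close>
lemma ab_winning_by_directions:
  fixes \<beta> :: real and D :: "(real \<times> real) list \<Rightarrow> bool"
  assumes \<beta>: "0 < \<beta>" "\<beta> < 1"
    and win: "\<And>e x. \<lbrakk>snd (e 0) > 0; \<And>i. snd (e (Suc i)) = (\<beta> / 2)\<^sup>2 * snd (e i);
        \<And>i. ball_of (e (Suc i)) \<subseteq> side \<beta> (D (map e [0..<Suc i])) (e i);
        \<And>i. x \<in> ball_of (e i)\<rbrakk> \<Longrightarrow> x \<in> Y"
  shows "ab_winning (1/2) \<beta> Y"
proof -
  \<comment> \<open>Only Bob's balls of even index are consulted. Histories ending in rounds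
    \<open>2 * i\<close> and \<open>2 * i + 1\<close> have lengths \<open>2 * i + 1\<close> and
    \<open>2 * i + 2\<close>; the index \<open>(length h - 1) div 2\<close> is \<open>i\<close> for
    both, so each decision is taken once and then repeated.\<close>
  define dir where "dir h = D (map (\<lambda>i. h ! (2 * i)) [0..<Suc ((length h - 1) div 2)])"
    for h :: "(real \<times> real) list"
  define strat where "strat h = (if dir h then fst (last h) - snd (last h) / 2
      else fst (last h) + snd (last h) / 2, snd (last h) / 2)" for h
  show ?thesis
    unfolding ab_winning_def Let_def
  proof (rule exI[of _ strat], intro allI impI)
    fix b :: "nat \<Rightarrow> real \<times> real"
    define e where "e i = b (2 * i)" for i
    define a where "a n = strat (map b [0..<Suc n])" for n
    assume "0 < snd (b 0) \<and> (\<forall>n. snd (b (Suc n)) = \<beta> * snd (strat (map b [0..<Suc n])) \<and>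
            ball_of (b (Suc n)) \<subseteq> ball_of (strat (map b [0..<Suc n])))"
    then have b0: "0 < snd (b 0)"
      and rad: "\<And>n. snd (b (Suc n)) = \<beta> * snd (a n)"
      and sub: "\<And>n. ball_of (b (Suc n)) \<subseteq> ball_of (a n)"
      by (auto simp: a_def)
    define dr where "dr i = D (map e [0..<Suc i])" for i
    have dir: "dir (map b [0..<Suc n]) = dr (n div 2)" for n
    proof -
      have "map (\<lambda>i. map b [0..<Suc n] ! (2 * i)) [0..<Suc (n div 2)] = map e [0..<Suc (n div 2)]"
        by (rule map_cong) (auto simp: e_def simp del: upt_Suc)
      then show ?thesis by (simp only: dir_def dr_def length_map length_upt diff_zero diff_Suc_1)
    qed
    have a: "a n = (if dr (n div 2) then fst (b n) - snd (b n) / 2 else fst (b n) + snd (b n) / 2,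
        snd (b n) / 2)" for n
      unfolding a_def strat_def dir by simp
    have rad': "snd (b (Suc n)) = \<beta> / 2 * snd (b n)" for n
      using rad[of n] by (simp add: a)
    have pos: "snd (b n) > 0" for n
    proof (induction n)
      case (Suc n)
      then show ?case unfolding rad' using \<beta> by simp
    qed (rule b0)
    have legal: "ball_of (a n) \<subseteq> ball_of (b n)" for n
      using pos[of n] by (auto simp: ball_of_eq a)
    have two: "ball_of (e (Suc i)) \<subseteq> side \<beta> (dr i) (e i)" for i
    proof -
      have s1: "ball_of (b (Suc (2 * i))) \<subseteq> ball_of (a (2 * i))" by (rule sub)
      have s2: "ball_of (e (Suc i)) \<subseteq> ball_of (a (Suc (2 * i)))"
        using sub[of "Suc (2 * i)"] by (simp add: e_def)
      have r: "snd (b (Suc (2 * i))) = \<beta> / 2 * snd (b (2 * i))" by (rule rad')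
      note p = pos[of "Suc (2 * i)"]
      have "fst (b (Suc (2 * i))) - snd (b (Suc (2 * i))) \<in> ball_of (a (2 * i))"
        "fst (b (Suc (2 * i))) + snd (b (Suc (2 * i))) \<in> ball_of (a (2 * i))"
        using p by (intro subsetD[OF s1]; simp add: ball_of_eq)+
      then have "ball_of (a (Suc (2 * i))) \<subseteq> side \<beta> (dr i) (e i)"
        using p unfolding r[symmetric] by (auto simp: ball_of_eq side_def a e_def r split: if_splits)
      with s2 show ?thesis by blast
    qed
    have "x \<in> Y" if x: "\<forall>n. x \<in> ball_of (a n)" for x
    proof (rule win)
      show "0 < snd (e 0)" using b0 by (simp add: e_def)
      show "snd (e (Suc i)) = (\<beta> / 2)\<^sup>2 * snd (e i)" for i
        by (simp add: e_def rad' power2_eq_square)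
      show "ball_of (e (Suc i)) \<subseteq> side \<beta> (D (map e [0..<Suc i])) (e i)" for i
        using two by (simp only: dr_def)
      show "x \<in> ball_of (e i)" for i
        using x legal[of "2 * i"] by (auto simp: e_def)
    qed
    then show "(\<forall>n. snd (strat (map b [0..<Suc n])) = 1 / 2 * snd (b n) \<and>
             ball_of (strat (map b [0..<Suc n])) \<subseteq> ball_of (b n)) \<and>
        (\<forall>x. (\<forall>n. x \<in> ball_of (strat (map b [0..<Suc n]))) \<longrightarrow> x \<in> Y)"
      using legal by (auto simp: a_def[symmetric] a simp del: upt_Suc)
  qed
qed

section \<open>Target intervals and their weighted count\<close>

definition danger :: "(real \<Rightarrow> nat \<Rightarrow> nat \<Rightarrow> real \<times> real \<Rightarrow> real) \<Rightarrow> real \<Rightarrow> real \<Rightarrow>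
    real \<Rightarrow> nat \<Rightarrow> nat \<Rightarrow> real \<times> real \<Rightarrow> real set" where
  "danger y \<eta> R \<rho> j k I = cball (y \<rho> j k I) (\<eta> * \<rho> / R ^ (j + k))"

text \<open>A target found in round \<open>j\<close> has to be avoided by round \<open>j + k + 7\<close>; its weight in
  round \<open>r\<close> reaches 1 exactly at that deadline.\<close>
definition potential :: "(real \<Rightarrow> nat \<Rightarrow> nat \<Rightarrow> real \<times> real \<Rightarrow> real) \<Rightarrow> real \<Rightarrow> real \<Rightarrow>
    (nat \<Rightarrow> real \<times> real) \<Rightarrow> nat \<Rightarrow> real set \<Rightarrow> real" where
  "potential y \<eta> R e r S = (\<Sum>j\<le>r. \<Sum>k\<le>j. (3/2) ^ r / (3/2) ^ (j + k + 7) *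
      of_bool (danger y \<eta> R (snd (e 0)) j k (e j) \<inter> S \<noteq> {}))"

text \<open>A target still alive at its deadline would have weight at least 1, so it suffices to
  keep the potential below 1. A target that is not overdue is too short to meet both sides, hence
  the lighter side carries at most half of the potential. This halving outweighs the growth of all
  weights by 3/2 and leaves room for the targets that appear in the new round.\<close>

lemma dodging:
  fixes \<beta> :: real
  assumes \<beta>: "0 < \<beta>" "\<beta> < 1"
    and R: "R = (2 / \<beta>)\<^sup>2" and \<eta>: "\<eta> = \<beta> / (4 * R ^ 7)"
    and e0: "snd (e 0) > 0" and rad: "\<And>i. snd (e (Suc i)) = (\<beta> / 2)\<^sup>2 * snd (e i)"
    and D: "\<And>i. ball_of (e (Suc i)) \<subseteq> side \<beta>
        (potential y \<eta> R e i (side \<beta> True (e i)) \<le> potential y \<eta> R e i (side \<beta> False (e i))) (e i)"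
    and k: "k \<le> j"
  shows "danger y \<eta> R (snd (e 0)) j k (e j) \<inter> ball_of (e (j + k + 7)) = {}"
proof -
  define \<rho> where "\<rho> = snd (e 0)"
  define w :: "nat \<Rightarrow> nat \<Rightarrow> nat \<Rightarrow> real" where "w r j k = (3/2) ^ r / (3/2) ^ (j + k + 7)" for r j k
  define J where "J j k = danger y \<eta> R \<rho> j k (e j)" for j k
  define W where "W r S = (\<Sum>j\<le>r. \<Sum>k\<le>j. w r j k * of_bool (J j k \<inter> S \<noteq> {}))" for r S
  have W: "potential y \<eta> R e = W"
    by (intro ext) (simp add: potential_def W_def w_def J_def \<rho>_def)
  have wpos: "w r j k \<ge> 0" for r j k by (simp add: w_def)
  have Rpos: "R > 1" unfolding R using \<beta> by (intro one_less_power) auto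
  have \<rho>: "\<rho> > 0" using e0 by (simp add: \<rho>_def)
  have er: "snd (e i) = \<rho> / R ^ i" for i
  proof (induction i)
    case (Suc i)
    then show ?case using \<beta> by (simp add: rad R field_simps power2_eq_square)
  qed (simp add: \<rho>_def)
  have erpos: "snd (e i) > 0" for i using er \<rho> Rpos by simp
  have sides: "side \<beta> d (e i) \<subseteq> ball_of (e i)" for d i
    using \<beta> erpos[of i] by (intro side_subset_ball_of) auto
  have dodged: "J j k \<inter> ball_of (e r) = {}"
    if "W r (ball_of (e r)) < 1" "k \<le> j" "j + k + 7 \<le> r" for r j k
  proof (rule ccontr)
    assume ne: "J j k \<inter> ball_of (e r) \<noteq> {}"
    have "1 \<le> w r j k"
      using that(3) by (simp add: w_def power_increasing)
    also have "\<dots> = w r j k * of_bool (J j k \<inter> ball_of (e r) \<noteq> {})" using ne by simp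
    also have "\<dots> \<le> (\<Sum>k\<le>j. w r j k * of_bool (J j k \<inter> ball_of (e r) \<noteq> {}))"
      using wpos that(2) by (intro member_le_sum) (auto intro: less_imp_le)
    also have "\<dots> \<le> W r (ball_of (e r))"
      unfolding W_def using wpos that(2,3)
      by (intro member_le_sum[where f = "\<lambda>j. \<Sum>k\<le>j. w r j k * of_bool (J j k \<inter> ball_of (e r) \<noteq> {})"])
         (auto intro!: sum_nonneg)
    finally show False using that(1) by simp
  qed
  have of_bool_le: "of_bool P + of_bool Q \<le> (of_bool S :: real)"
    if "P \<Longrightarrow> S" "Q \<Longrightarrow> S" "\<not> (P \<and> Q)" for P Q S
    using that by auto
  have split: "of_bool (J j k \<inter> side \<beta> True (e r) \<noteq> {}) + of_bool (J j k \<inter> side \<beta> False (e r) \<noteq> {})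
      \<le> (of_bool (J j k \<inter> ball_of (e r) \<noteq> {}) :: real)"
    if "W r (ball_of (e r)) < 1" "k \<le> j" "j \<le> r" for r j k
  proof (cases "j + k + 7 \<le> r")
    case True
    then have "J j k \<inter> ball_of (e r) = {}" using dodged that by blast
    then show ?thesis using sides[of _ r] by (intro of_bool_le) blast+
  next
    case False
    have "\<not> (J j k \<inter> side \<beta> True (e r) \<noteq> {} \<and> J j k \<inter> side \<beta> False (e r) \<noteq> {})"
    proof
      assume "J j k \<inter> side \<beta> True (e r) \<noteq> {} \<and> J j k \<inter> side \<beta> False (e r) \<noteq> {}"
      then obtain u v where "u \<in> J j k" "v \<in> J j k" "u \<in> side \<beta> True (e r)" "v \<in> side \<beta> False (e r)"
        by blast
      \<comment> \<open>The sides are \<open>\<beta> * snd (e r)\<close> apart. The value of \<eta>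
        makes the diameter of a target half of this gap in the deadline round, and a still smaller
        part of it before.\<close>
      then have "\<beta> * snd (e r) \<le> 2 * (\<eta> * \<rho> / R ^ (j + k))"
        by (auto simp: J_def danger_def side_def dist_real_def)
      also have "\<dots> = \<beta> / 2 * (\<rho> / R ^ (j + k + 7))"
        by (simp add: \<eta> power_add)
      also have "\<dots> \<le> \<beta> / 2 * (\<rho> / R ^ r)"
        using False Rpos \<beta> \<rho> by (intro mult_left_mono divide_left_mono power_increasing) auto
      also have "\<dots> < \<beta> * snd (e r)" 
        using mult_pos_pos[OF \<beta>(1) erpos[of r]] unfolding er[symmetric] by simp
      finally show False by simp
    qed
    then show ?thesis using sides[of _ r] by (intro of_bool_le) blast+
  qed
  \<comment> \<open>12 is the fixed point of x -> 3/4 x + 3: old targets are halved and then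
    multiplied by 3/2, and the new ones add at most the geometric series of ratio 2/3, whose sum is
    3. The 7 extra rounds before each deadline are the least number with
    \<open>(3/2) ^ 7 > 12\<close>.\<close>
  have main: "W r (ball_of (e r)) \<le> 12 / (3/2) ^ 7" for r
  proof (induction r)
    case 0
    show ?case by (simp add: W_def w_def power_divide)
  next
    case (Suc r)
    have lt1: "W r (ball_of (e r)) < 1" using Suc by (rule order.strict_trans1) (simp add: power_divide)
    have "W r (side \<beta> True (e r)) + W r (side \<beta> False (e r)) =
        (\<Sum>j\<le>r. \<Sum>k\<le>j. w r j k * (of_bool (J j k \<inter> side \<beta> True (e r) \<noteq> {})
           + of_bool (J j k \<inter> side \<beta> False (e r) \<noteq> {})))"
      unfolding W_def by (simp add: sum.distrib distrib_left)
    also have "\<dots> \<le> W r (ball_of (e r))"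
      unfolding W_def
      by (intro sum_mono mult_left_mono split lt1) (use wpos in auto)
    finally have half: "W r (side \<beta> (W r (side \<beta> True (e r)) \<le> W r (side \<beta> False (e r))) (e r))
        \<le> W r (ball_of (e r)) / 2"
      by (cases "W r (side \<beta> True (e r)) \<le> W r (side \<beta> False (e r))") auto
    have mono: "W r S \<le> W r S'" if "S \<subseteq> S'" for S S'
      unfolding W_def
      by (intro sum_mono mult_left_mono) (use wpos that in \<open>auto simp: of_bool_def\<close>)
    have old: "W r (ball_of (e (Suc r))) \<le> W r (ball_of (e r)) / 2"
      using mono[OF D[of r, unfolded W]] half by linarith
    have "W (Suc r) (ball_of (e (Suc r))) = 3/2 * W r (ball_of (e (Suc r))) +
       (\<Sum>k\<le>Suc r. w (Suc r) (Suc r) k * of_bool (J (Suc r) k \<inter> ball_of (e (Suc r)) \<noteq> {}))"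
      by (simp add: W_def w_def sum_distrib_left mult.assoc)
    also have "(\<Sum>k\<le>Suc r. w (Suc r) (Suc r) k * of_bool (J (Suc r) k \<inter> ball_of (e (Suc r)) \<noteq> {}))
      \<le> (\<Sum>k\<le>Suc r. (2/3) ^ k / (3/2) ^ 7)"
    proof (rule sum_mono)
      fix k
      have "w (Suc r) (Suc r) k * of_bool (J (Suc r) k \<inter> ball_of (e (Suc r)) \<noteq> {}) \<le> w (Suc r) (Suc r) k * 1"
        by (intro mult_left_mono) (use wpos in auto)
      also have "\<dots> = (2/3) ^ k / (3/2) ^ 7"
        by (simp add: w_def power_add power_divide)
      finally show "w (Suc r) (Suc r) k * of_bool (J (Suc r) k \<inter> ball_of (e (Suc r)) \<noteq> {})
        \<le> (2/3) ^ k / (3/2) ^ 7" .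
    qed
    also have "\<dots> = (\<Sum>k\<le>Suc r. (2/3) ^ k) / (3/2) ^ 7" by (simp only: sum_divide_distrib)
    also have "\<dots> \<le> 3 / (3/2) ^ 7"
      by (intro divide_right_mono) (simp_all only: sum_gp0, simp_all)
    finally show ?case using old Suc by simp
  qed
  have "W (j + k + 7) (ball_of (e (j + k + 7))) < 1"
    using main by (rule order.strict_trans1) (simp add: power_divide)
  then show ?thesis using dodged k unfolding J_def \<rho>_def by blast
qed

section \<open>From the game to a covering property\<close>

text \<open>Round \<open>j\<close> takes care of the sets \<open>Z \<rho> (j + k) k\<close> with
  \<open>k \<le> j\<close>, that is, of all \<open>Z \<rho> n k\<close> with
  \<open>2 * k \<le> n\<close>, where \<open>n = j + k\<close>. Its deadline
  \<open>j + k + 7\<close> is \<open>n + 7\<close>, independent of \<open>k\<close>. The covering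
  property in round \<open>j\<close> presupposes only sets whose deadlines have been reached by
  then, so a strong induction on the round closes the argument.\<close>

lemma ab_winning_by_covering:
  fixes \<beta> :: real and Z :: "real \<Rightarrow> nat \<Rightarrow> nat \<Rightarrow> real set"
  assumes \<beta>: "0 < \<beta>" "\<beta> < 1"
    and R: "R = (2 / \<beta>)\<^sup>2" and \<eta>: "\<eta> = \<beta> / (4 * R ^ 7)"
    and cover: "\<And>\<rho> j k I. \<lbrakk>\<rho> > 0; k \<le> j; snd I = \<rho> / R ^ j;
        \<And>n k'. \<lbrakk>2 * k' \<le> n; n + 7 \<le> j\<rbrakk> \<Longrightarrow> ball_of I \<inter> Z \<rho> n k' = {}\<rbrakk> \<Longrightarrow>
        \<exists>y. Z \<rho> (j + k) k \<inter> ball_of I \<subseteq> cball y (\<eta> * \<rho> / R ^ (j + k))"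
    and Y: "\<And>\<rho> x. \<lbrakk>\<rho> > 0; \<And>n k. 2 * k \<le> n \<Longrightarrow> x \<notin> Z \<rho> n k\<rbrakk> \<Longrightarrow> x \<in> Y"
  shows "ab_winning (1/2) \<beta> Y"
proof -
  \<comment> \<open>The centre is a function of the current ball alone, as a strategy requires. For
    balls without a covering interval the choice is arbitrary; along an actual play the induction
    below shows that it is a genuine one.\<close>
  define y where "y \<rho> j k I = (SOME y. Z \<rho> (j + k) k \<inter> ball_of I \<subseteq> cball y (\<eta> * \<rho> / R ^ (j + k)))"
    for \<rho> j k and I :: "real \<times> real"
  define D where "D h = (let P = potential y \<eta> R (\<lambda>i. h ! i) (length h - 1) in
      P (side \<beta> True (last h)) \<le> P (side \<beta> False (last h)))" for h
  show ?thesis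
  proof (rule ab_winning_by_directions[OF \<beta>, of D])
    fix e :: "nat \<Rightarrow> real \<times> real" and x
    assume e0: "snd (e 0) > 0" and rad: "\<And>i. snd (e (Suc i)) = (\<beta> / 2)\<^sup>2 * snd (e i)"
      and dir: "\<And>i. ball_of (e (Suc i)) \<subseteq> side \<beta> (D (map e [0..<Suc i])) (e i)"
      and x: "\<And>i. x \<in> ball_of (e i)"
    define \<rho> where "\<rho> = snd (e 0)"
    have er: "snd (e i) = \<rho> / R ^ i" for i
    proof (induction i)
      case (Suc i)
      then show ?case using \<beta> by (simp add: rad R field_simps power2_eq_square)
    qed (simp add: \<rho>_def)
    have pot: "potential y \<eta> R (\<lambda>j. map e [0..<Suc i] ! j) i S = potential y \<eta> R e i S" for i S
      unfolding potential_def by (intro sum.cong refl) (simp del: upt_Suc)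
    have dir': "ball_of (e (Suc i)) \<subseteq> side \<beta>
        (potential y \<eta> R e i (side \<beta> True (e i)) \<le> potential y \<eta> R e i (side \<beta> False (e i))) (e i)" for i
    proof -
      have "last (map e [0..<Suc i]) = e i" by simp
      then show ?thesis
        using dir[of i] by (simp only: D_def Let_def pot length_map length_upt diff_zero diff_Suc_1)
    qed
    note dodge = dodging[where e = e and y = y, OF \<beta> R \<eta> e0 rad dir', folded \<rho>_def]
    have pos: "snd (e i) \<ge> 0" for i
    proof -
      have "0 \<le> R" by (simp add: R)
      then show ?thesis using e0[folded \<rho>_def] by (simp add: er)
    qed
    have "decseq (\<lambda>i. ball_of (e i))"
      unfolding decseq_Suc_iff
      using \<beta> pos by (intro allI order_trans[OF dir'] side_subset_ball_of) auto
    then have nested: "ball_of (e i) \<subseteq> ball_of (e j)" if "j \<le> i" for i j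
      using that by (simp add: decseq_def)
    have avoid: "ball_of (e j) \<inter> Z \<rho> n k = {}" if "2 * k \<le> n" "n + 7 \<le> j" for j n k
      using that
    proof (induction j arbitrary: n k rule: less_induct)
      case (less j)
      \<comment> \<open>\<open>Z \<rho> n k\<close> became a target in round \<open>n - k\<close>,
        which precedes \<open>j\<close>; the induction hypothesis supplies the avoidance that the
        covering needs in that round.\<close>
      define i where "i = n - k"
      have i: "n = i + k" "k \<le> i" "i < j" using less.prems by (auto simp: i_def)
      have "\<exists>y. Z \<rho> (i + k) k \<inter> ball_of (e i) \<subseteq> cball y (\<eta> * \<rho> / R ^ (i + k))"
        by (rule cover) (use e0[folded \<rho>_def] i er less.IH in auto)
      then have "Z \<rho> (i + k) k \<inter> ball_of (e i) \<subseteq> danger y \<eta> R \<rho> i k (e i)"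
        unfolding danger_def y_def by (rule someI_ex)
      moreover have "ball_of (e j) \<subseteq> ball_of (e i)" "ball_of (e j) \<subseteq> ball_of (e (i + k + 7))"
        using less.prems i by (auto intro!: nested)
      ultimately show ?case using dodge[OF i(2)] i(1) by blast
    qed
    show "x \<in> Y"
      by (rule Y[of \<rho>]) (use e0[folded \<rho>_def] avoid[OF _ order.refl] x in blast)+
  qed
qed

section \<open>Rational points and lines\<close>

text \<open>Pigeonhole: there are more than \<open>q\<close> pairs \<open>(i, j)\<close> with 0
  \<le> i \<le> q^s and 0 \<le> j \<le> q^t, but only \<open>q\<close> residues of i p + j r modulo
  \<open>q\<close>. The difference of two colliding pairs gives \<open>A\<close> and
  \<open>B\<close>.\<close>

lemma line_through_rational_point:
  fixes p r q :: int and s t :: real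
  assumes q: "0 < q" and st: "s + t = 1"
  shows "\<exists>A B C :: int. (A, B) \<noteq> (0, 0) \<and> \<bar>real_of_int A\<bar> \<le> real_of_int q powr s \<and>
    \<bar>real_of_int B\<bar> \<le> real_of_int q powr t \<and> A * p + B * r + C * q = 0"
proof -
  define a b where "a = nat \<lfloor>real_of_int q powr s\<rfloor>" and "b = nat \<lfloor>real_of_int q powr t\<rfloor>"
  define f where "f = (\<lambda>(i, j). (int i * p + int j * r) mod q)"
  have a: "real a \<le> real_of_int q powr s" "real_of_int q powr s < real (Suc a)"
    unfolding a_def by (auto simp: of_nat_nat) linarith+
  have b: "real b \<le> real_of_int q powr t" "real_of_int q powr t < real (Suc b)"
    unfolding b_def by (auto simp: of_nat_nat) linarith+
  have "real_of_int q = real_of_int q powr s * real_of_int q powr t"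
    using q st by (simp flip: powr_add)
  also have "\<dots> < real (Suc a) * real (Suc b)"
    using a b q by (intro mult_strict_mono) auto
  finally have "q < int (Suc a * Suc b)" by (metis of_int_less_iff of_int_of_nat_eq of_nat_mult)
  then have "card {0..<q} < card ({..a} \<times> {..b})" using q by (simp only: card_cartesian_product card_atMost card_atLeastLessThan_int)
  moreover have "f ` ({..a} \<times> {..b}) \<subseteq> {0..<q}" using q by (auto simp: f_def)
  ultimately have "\<not> inj_on f ({..a} \<times> {..b})"
    by (meson card_inj_on_le finite_atLeastLessThan_int not_le)
  then obtain i j i' j' where ij: "i \<le> a" "i' \<le> a" "j \<le> b" "j' \<le> b" "(i, j) \<noteq> (i', j')"
    "f (i, j) = f (i', j')" unfolding inj_on_def by auto
  then have "q dvd (int i * p + int j * r) - (int i' * p + int j' * r)"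
    by (simp add: f_def mod_eq_dvd_iff)
  then obtain C where "(int i * p + int j * r) - (int i' * p + int j' * r) = q * C" ..
  then have "(int i - int i') * p + (int j - int j') * r + (- C) * q = 0" by (simp add: algebra_simps)
  moreover have "(int i - int i', int j - int j') \<noteq> (0, 0)" using ij by auto
  moreover have "\<bar>real_of_int (int i - int i')\<bar> \<le> real_of_int q powr s"
    using ij a by (auto simp: abs_if)
  moreover have "\<bar>real_of_int (int j - int j')\<bar> \<le> real_of_int q powr t"
    using ij b by (auto simp: abs_if)
  ultimately show ?thesis by blast
qed

lemma powr_le_imp_le:
  fixes x y a :: real
  assumes "x powr a \<le> y powr a" "0 < a" "0 \<le> y"
  shows "x \<le> y"
  using assms powr_less_mono2[of a y x] by (meson not_le)

text \<open>Pairs a coefficient controlled by one denominator with an approximation error controlled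
  by another. The ratio \<open>W\<close> of the denominators enters as W^s, which is at most
  \<open>W\<close>. It serves both exponents, and with \<open>W = 1\<close> both quantities belong
  to the same rational point.\<close>

lemma scaled_product_bound:
  fixes A \<epsilon> q1 q2 s c W :: real
  assumes "\<bar>A\<bar> \<le> q1 powr s" "\<bar>\<epsilon>\<bar> * q2 powr s < c" "0 \<le> s" "s \<le> 1" "0 < q1" "0 < q2" "q1 \<le> W * q2" "1 \<le> W"
  shows "\<bar>A * \<epsilon>\<bar> \<le> c * W"
proof -
  have "q1 powr s \<le> (W * q2) powr s" using assms by (intro powr_mono2) auto
  also have "\<dots> = W powr s * q2 powr s" using assms by (simp add: powr_mult)
  also have "\<dots> \<le> W * q2 powr s"
    using assms powr_mono[of s 1 W] by (intro mult_right_mono) auto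
  finally have "\<bar>A\<bar> * \<bar>\<epsilon>\<bar> \<le> (W * q2 powr s) * \<bar>\<epsilon>\<bar>" using assms(1) by (intro mult_right_mono) auto
  also have "\<dots> = W * (\<bar>\<epsilon>\<bar> * q2 powr s)" by simp
  also have "\<dots> \<le> W * c" using assms by (intro mult_left_mono) auto
  finally show ?thesis by (simp add: abs_mult mult.commute)
qed

text \<open>\<open>R\<close> is the ratio of the radii of consecutive balls and \<open>\<rho>\<close> the initial radius. An interval found
  \<open>k\<close> rounds ahead of its natural scale is left after \<open>k + M\<close> rounds. The condition \<open>gap\<close> makes the
  intersection points of lines of level \<open>k > 0\<close> small enough to have been avoided by then.\<close>
locale line_zones =
  fixes s t \<theta> R c c1 \<rho> \<eta> :: real and K l M :: nat
  assumes s: "0 \<le> s" and t: "0 < t" and st: "s + t = 1"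
    and R: "1 < R" and \<eta>: "0 < \<eta>" "\<eta> \<le> 1" and \<rho>: "0 < \<rho>"
    and c1: "0 < c1" "c1 \<le> \<rho>" "6 * c1 * R ^ (K + 2) \<le> 1" and c: "c = \<eta> * c1 / 4"
    and l: "2 \<le> l" "l \<le> K"
    and gap: "\<And>k. 1 \<le> k \<Longrightarrow> 96 * R ^ (k + l + M + 2) < \<eta> * (R ^ (K + l * (k - 1) - 1)) powr t"
    and \<theta>: "s = 0 \<or> (\<forall>A C. A \<noteq> 0 \<longrightarrow> c \<le> \<bar>real_of_int A\<bar> powr (1 / s) * \<bar>of_int A * \<theta> + of_int C\<bar>)"
begin

text \<open>Normalised so that \<open>c1 / h n\<close> is the radius \<open>\<rho> / R ^ n\<close>
  of Bob's ball in round \<open>n\<close>. As \<open>c1 \<le> \<rho>\<close>, \<open>h 0\<close> is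
  at most 1, so every product \<open>q * B\<close> of positive integers has a scale.\<close>

definition h :: "nat \<Rightarrow> real" where "h n = c1 / \<rho> * R ^ n"

text \<open>Denominator \<open>q\<close> violates the inequality of \<open>Bad\<close> with constant
  \<open>c\<close> at \<open>(\<theta>, x)\<close>. The fractions need not be reduced, so the
  intersection of two lines can be inserted just as Cramer's rule delivers it.\<close>

definition point :: "real \<Rightarrow> int \<Rightarrow> int \<Rightarrow> int \<Rightarrow> bool" where
  "point x p r q \<longleftrightarrow> q > 0 \<and> \<bar>of_int q * \<theta> - of_int p\<bar> * of_int q powr s < c \<and>
     \<bar>of_int q * x - of_int r\<bar> * of_int q powr t < c"

text \<open>A nonvertical line, with the sign of its coefficients normalised; a vertical one would
  have no height above \<theta>.\<close>

definition line :: "int \<Rightarrow> int \<Rightarrow> int \<Rightarrow> int \<Rightarrow> int \<Rightarrow> int \<Rightarrow> bool" where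
  "line p r q A B C \<longleftrightarrow> B > 0 \<and> A * p + B * r + C * q = 0 \<and>
     \<bar>real_of_int A\<bar> \<le> of_int q powr s \<and> of_int B \<le> real_of_int q powr t"

text \<open>The lower bound on \<open>q\<^sup>t / B\<close> is dropped for \<open>k = 0\<close>, so that every line has a level.\<close>
definition level :: "nat \<Rightarrow> nat \<Rightarrow> int \<Rightarrow> int \<Rightarrow> bool" where
  "level n k q B \<longleftrightarrow> h n \<le> of_int q * of_int B \<and> of_int q * of_int B < h (Suc n) \<and>
     (k = 0 \<or> R ^ (K + l * (k - 1)) * of_int B \<le> of_int q powr t) \<and>
     of_int q powr t < R ^ (K + l * k) * of_int B"

definition zone :: "nat \<Rightarrow> nat \<Rightarrow> real set" where
  "zone n k = {x. \<exists>p r q A B C. point x p r q \<and> line p r q A B C \<and> level n k q B}"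

section \<open>Every approximating rational point has a line and a level\<close>

lemma h_pos: "h n > 0" using c1 \<rho> R by (simp add: h_def)

lemma h_mono: "m \<le> n \<Longrightarrow> h m \<le> h n"
  unfolding h_def using c1 \<rho> R by (intro mult_left_mono power_increasing) auto

lemma h_le_power: "h n \<le> R ^ n"
  using c1 \<rho> R by (simp add: h_def field_simps)

lemma c_pos: "0 < c" and c_le: "c \<le> c1 / 4" and c1_le: "6 * c1 \<le> 1"
proof -
  show "0 < c" unfolding c using \<eta> c1 by simp
  show "c \<le> c1 / 4" unfolding c using \<eta> c1 by (simp add: mult_left_le_one_le)
  have "6 * c1 * 1 \<le> 6 * c1 * R ^ (K + 2)" using c1 R by (intro mult_left_mono one_le_power) auto
  then show "6 * c1 \<le> 1" using c1(3) by linarith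
qed

lemma t_le: "t \<le> 1" and s_less: "s < 1" using s t st by auto

lemma h_ex: assumes "1 \<le> H" shows "\<exists>n. h n \<le> H \<and> H < h (Suc n)"
proof -
  have "\<exists>n. H < h n"
  proof -
    obtain n where "H * \<rho> / c1 < R ^ n" using real_arch_pow[OF R] by blast
    then show ?thesis using c1 \<rho> by (auto simp: h_def field_simps intro!: exI[of _ n])
  qed
  then obtain n where n: "H < h n" "\<And>m. m < n \<Longrightarrow> \<not> H < h m" using exists_least_iff[of "\<lambda>n. H < h n"] by blast
  have "n \<noteq> 0"
  proof
    assume "n = 0"
    then have "H < h 0" using n by simp
    also have "\<dots> \<le> 1" using h_le_power[of 0] by simp
    finally show False using assms by simp
  qed
  then obtain m where "n = Suc m" using not0_implies_Suc by blast
  then show ?thesis using n by (intro exI[of _ m]) (auto simp: not_less)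
qed

text \<open>If the pigeonhole line were vertical, then q |A \<theta> + C| = |A| |q \<theta> - p| < c
  while |A|^(1/s) \<le> q, against the assumption on \<theta>. For \<open>s = 0\<close> that
  assumption is void, but then \<open>t = 1\<close> and the horizontal line through the point is
  admissible with \<open>B = q\<close>.\<close>

lemma line_ex:
  assumes "point x p r q"
  shows "\<exists>A B C. line p r q A B C"
proof (cases "s = 0")
  case True
  have q: "q > 0" using assms by (simp add: point_def)
  have "t = 1" using True st by simp
  then have "line p r q 0 q (- r)" using q unfolding line_def by simp
  then show ?thesis by blast
next
  case False
  have q: "q > 0" and p: "\<bar>of_int q * \<theta> - of_int p\<bar> * of_int q powr s < c"
    using assms by (auto simp: point_def)
  obtain A B C where L: "(A, B) \<noteq> (0, 0)" "\<bar>real_of_int A\<bar> \<le> real_of_int q powr s"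
    "\<bar>real_of_int B\<bar> \<le> real_of_int q powr t" "A * p + B * r + C * q = 0"
    using line_through_rational_point[OF q st] by blast
  have "B \<noteq> 0"
  proof
    assume B: "B = 0"
    then have A: "A \<noteq> 0" using L by auto
    have "of_int A * of_int p + of_int C * of_int q = (0 :: real)"
      using L(4) B by (metis add.right_neutral mult_zero_left of_int_0 of_int_add of_int_mult)
    then have "of_int q * (of_int A * \<theta> + of_int C) = of_int A * (of_int q * \<theta> - of_int p)"
      by (simp add: algebra_simps)
    then have "of_int q * \<bar>of_int A * \<theta> + of_int C\<bar> = \<bar>real_of_int A\<bar> * \<bar>of_int q * \<theta> - of_int p\<bar>"
      using q by (metis abs_mult abs_of_pos of_int_0_less_iff)
    also have "\<dots> \<le> of_int q powr s * \<bar>of_int q * \<theta> - of_int p\<bar>"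
      using L by (intro mult_right_mono) auto
    also have "\<dots> < c" using p by (simp add: mult.commute)
    finally have lt: "of_int q * \<bar>of_int A * \<theta> + of_int C\<bar> < c" .
    have "\<bar>real_of_int A\<bar> powr (1 / s) \<le> (of_int q powr s) powr (1 / s)"
      using L s by (intro powr_mono2) auto
    also have "\<dots> = of_int q" using q False by (simp add: powr_powr)
    finally have "\<bar>real_of_int A\<bar> powr (1 / s) * \<bar>of_int A * \<theta> + of_int C\<bar> \<le> of_int q * \<bar>of_int A * \<theta> + of_int C\<bar>"
      by (intro mult_right_mono) auto
    then show False using \<theta> False A lt by (meson le_less_trans not_le order_less_le_trans)
  qed
  show ?thesis
  proof (cases "B > 0")
    case True
    then show ?thesis using L unfolding line_def by (intro exI[of _ A] exI[of _ B] exI[of _ C]) auto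
  next
    case False
    then show ?thesis using L \<open>B \<noteq> 0\<close> unfolding line_def
      by (intro exI[of _ "- A"] exI[of _ "- B"] exI[of _ "- C"]) auto
  qed
qed

text \<open>\<open>n\<close> is the scale of q B, and \<open>k\<close> is the least index for which
  the upper bound in \<open>level\<close> holds. The final estimate on \<open>h n\<close> later
  tells how early a point of small denominator must have been dealt with.\<close>

lemma zone_ex:
  assumes P: "point x p r q"
  shows "\<exists>n k. 2 * k \<le> n \<and> x \<in> zone n k \<and> h n \<le> of_int q powr (1 + t)"
proof -
  obtain A B C where L: "line p r q A B C" using line_ex[OF P] by blast
  have q: "1 \<le> real_of_int q" using P by (simp add: point_def)
  have B: "1 \<le> real_of_int B" "of_int B \<le> real_of_int q powr t" using L by (auto simp: line_def)
  have "1 * 1 \<le> real_of_int q * of_int B" using q B by (intro mult_mono) auto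
  then obtain n where n: "h n \<le> real_of_int q * of_int B" "real_of_int q * of_int B < h (Suc n)"
    using h_ex[of "real_of_int q * of_int B"] by auto
  obtain m where m: "real_of_int q powr t < R ^ m" using real_arch_pow[OF R] by blast
  have "real_of_int q powr t < R ^ (K + l * m) * of_int B"
  proof -
    have "1 * m \<le> l * m" using l by (intro mult_right_mono) auto
    then have "R ^ m * 1 \<le> R ^ (K + l * m) * of_int B"
      using R B by (intro mult_mono power_increasing trans_le_add2) (auto simp: mult.commute)
    then show ?thesis using m by simp
  qed
  then obtain k where k: "real_of_int q powr t < R ^ (K + l * k) * of_int B"
      "\<And>k'. k' < k \<Longrightarrow> \<not> real_of_int q powr t < R ^ (K + l * k') * of_int B"
    using exists_least_iff[of "\<lambda>k. real_of_int q powr t < R ^ (K + l * k) * of_int B"] by blast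
  have k': "k = 0 \<or> R ^ (K + l * (k - 1)) * of_int B \<le> real_of_int q powr t"
    using k(2)[of "k - 1"] by (cases k) auto
  have "2 * k \<le> n"
  \<comment> \<open>For \<open>k > 0\<close> the chain R^(K + l (k - 1)) \<le> q^t \<le> q B < R^(n
    + 1) bounds the exponent; then \<open>l \<le> K\<close> and \<open>2 \<le> l\<close> give
    \<open>2 * k \<le> n\<close>.\<close>
  proof (cases "k = 0")
    case False
    have "R ^ (K + l * (k - 1)) * 1 \<le> R ^ (K + l * (k - 1)) * of_int B"
      using R B by (intro mult_left_mono) auto
    also have "\<dots> \<le> real_of_int q powr t" using k' False by simp
    also have "\<dots> \<le> real_of_int q" using q t_le powr_mono[of t 1 "real_of_int q"] by simp
    also have "\<dots> \<le> real_of_int q * of_int B" using q B by simp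
    also have "\<dots> < h (Suc n)" by (rule n)
    also have "\<dots> \<le> R ^ Suc n" by (rule h_le_power)
    finally have "K + l * (k - 1) < Suc n" using R by (simp add: power_strict_increasing_iff del: power_Suc)
    moreover have "l * k = l + l * (k - 1)" using False by (cases k) auto
    moreover have "2 * k \<le> l * k" using l by simp
    ultimately show ?thesis using l by linarith
  qed simp
  moreover have "x \<in> zone n k"
    using P L n k k' unfolding zone_def level_def by blast
  moreover have "h n \<le> of_int q powr (1 + t)"
  proof -
    have "h n \<le> real_of_int q * of_int q powr t"
      using n(1) B q by (smt (verit) mult_left_mono)
    also have "\<dots> = of_int q powr (1 + t)" using q by (simp add: powr_add)
    finally show ?thesis .
  qed
  ultimately show ?thesis by blast
qed

section \<open>Heights of lines in one group\<close>

definition height :: "int \<Rightarrow> int \<Rightarrow> int \<Rightarrow> real" where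
  "height A B C = - (of_int A * \<theta> + of_int C) / of_int B"

lemma height_eq: "B > 0 \<Longrightarrow> of_int A * \<theta> + of_int B * height A B C + of_int C = 0"
  by (simp add: height_def field_simps)

lemma line_real:
  assumes "line p r q A B C"
  shows "real_of_int A * of_int p + of_int B * of_int r + of_int C * of_int q = 0"
  using assms unfolding line_def by (metis of_int_0 of_int_add of_int_mult)

text \<open>Multiplied by q B, the distances of r/q from the height and from \<open>x\<close> become
  |A (q \<theta> - p)| and |B (q x - r)|. Each is at most \<open>c\<close>, since |A| \<le> q^s and
  B \<le> q^t.\<close>

lemma height_near:
  assumes P: "point x p r q" and L: "line p r q A B C"
  shows "\<bar>x - height A B C\<bar> * (of_int q * of_int B) \<le> 2 * c"
    and "\<bar>of_int r / of_int q - height A B C\<bar> * (of_int q * of_int B) \<le> c"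
proof -
  define y where "y = height A B C"
  have q: "0 < real_of_int q" and B: "0 < real_of_int B" using P L by (auto simp: point_def line_def)
  have y: "of_int A * \<theta> + of_int B * y + of_int C = 0"
    using height_eq L by (simp add: y_def line_def)
  have a: "\<bar>of_int A * (of_int q * \<theta> - of_int p)\<bar> \<le> c * 1"
    using P L q s s_less by (intro scaled_product_bound[of _ "of_int q" s _ "of_int q"]) (auto simp: point_def line_def)
  have b: "\<bar>of_int B * (of_int q * x - of_int r)\<bar> \<le> c * 1"
    using P L q t t_le by (intro scaled_product_bound[of _ "of_int q" t _ "of_int q"]) (auto simp: point_def line_def)
  have 2: "(of_int r / of_int q - y) * (of_int q * of_int B) = of_int A * (of_int q * \<theta> - of_int p)"
  proof -
    have "(of_int r / of_int q - y) * (of_int q * of_int B) = of_int r * of_int B - of_int q * (of_int B * y)"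
      using q by (simp add: field_simps)
    also have "of_int B * y = - (of_int A * \<theta> + of_int C)" using y by linarith
    finally show ?thesis using line_real[OF L] by (simp add: algebra_simps)
  qed
  have 1: "(x - y) * (of_int q * of_int B) = of_int B * (of_int q * x - of_int r) + of_int A * (of_int q * \<theta> - of_int p)"
    using q unfolding 2[symmetric] by (simp add: field_simps)
  show "\<bar>of_int r / of_int q - height A B C\<bar> * (of_int q * of_int B) \<le> c"
    using arg_cong[OF 2, of abs] a q B by (simp add: abs_mult y_def)
  have "\<bar>x - y\<bar> * (of_int q * of_int B) = \<bar>(x - y) * (of_int q * of_int B)\<bar>"
    using q B by (simp add: abs_mult)
  then show "\<bar>x - height A B C\<bar> * (of_int q * of_int B) \<le> 2 * c"
    using a b unfolding y_def[symmetric] 1 by linarith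
qed

text \<open>Inserting the second point into the first line gives an integer \<open>N\<close>, which
  is shown to have absolute value below 1. In level 0, q B and q^(1 + t) agree up to the factor R^K,
  so the denominators at one scale differ at most by the factor \<open>W\<close>.\<close>

lemma point_on_line:
  assumes P1: "point x1 p1 r1 q1" and L1: "line p1 r1 q1 A B C" and l1: "level n 0 q1 B"
    and P2: "point x2 p2 r2 q2" and L2: "line p2 r2 q2 A2 B2 C2" and l2: "level n 0 q2 B2"
    and x: "\<bar>x1 - x2\<bar> \<le> 2 * \<rho> / R ^ n"
  shows "A * p2 + B * r2 + C * q2 = 0"
proof -
  define Q1 Q2 where "Q1 = real_of_int q1" and "Q2 = real_of_int q2"
  define W where "W = R ^ (K + 1)"
  have W: "1 \<le> W" unfolding W_def using R by (intro one_le_power) auto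
  have Q: "0 < Q1" "0 < Q2" using P1 P2 by (auto simp: Q1_def Q2_def point_def)
  have ratio: "real_of_int q' \<le> W * real_of_int q"
    if "q > 0" "q' > 0" and lv: "level n 0 q b" "level n 0 q' b'" and b: "real_of_int b \<le> real_of_int q powr t" for q q' b b'
  proof (rule ccontr)
    assume "\<not> real_of_int q' \<le> W * real_of_int q"
    then have "(W * real_of_int q) powr (1 + t) < real_of_int q' powr (1 + t)"
      using W that t by (intro powr_less_mono2) auto
    also have "\<dots> = of_int q' * of_int q' powr t" using that by (simp add: powr_add)
    also have "\<dots> \<le> of_int q' * (R ^ K * of_int b')"
      using that lv(2) by (intro mult_left_mono) (auto simp: level_def)
    also have "\<dots> = R ^ K * (of_int q' * of_int b')" by simp
    also have "\<dots> \<le> R ^ K * h (Suc n)" using lv(2) R by (intro mult_left_mono) (auto simp: level_def)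
    also have "\<dots> = W * h n" by (simp add: h_def W_def)
    also have "\<dots> \<le> W * (of_int q * of_int b)" using lv(1) W by (intro mult_left_mono) (auto simp: level_def)
    also have "\<dots> \<le> W * (of_int q * of_int q powr t)" using W b that by (intro mult_left_mono) auto
    also have "\<dots> = W * of_int q powr (1 + t)" using that by (simp add: powr_add)
    also have "\<dots> \<le> W powr (1 + t) * of_int q powr (1 + t)"
      using W t powr_mono[of 1 "1 + t" W] by (intro mult_right_mono) auto
    also have "\<dots> = (W * of_int q) powr (1 + t)" using W that by (simp add: powr_mult)
    finally show False by simp
  qed
  have r1: "Q2 \<le> W * Q1" "Q1 \<le> W * Q2"
    unfolding Q1_def Q2_def using P1 P2 L1 L2 l1 l2
    by (auto intro!: ratio simp: point_def line_def)
  have Bpos: "0 < real_of_int B" using L1 by (simp add: line_def)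
  define N where "N = A * p2 + B * r2 + C * q2"
  define e1 e2 f1 f2 where "e1 = Q1 * \<theta> - of_int p1" and "e2 = Q2 * \<theta> - of_int p2"
    and "f1 = Q1 * x1 - of_int r1" and "f2 = Q2 * x2 - of_int r2"
  have e1: "\<bar>of_int A * e1\<bar> \<le> c * 1"
    using P1 L1 Q s s_less unfolding e1_def Q1_def
    by (intro scaled_product_bound[of _ "of_int q1" s _ "of_int q1"]) (auto simp: point_def line_def)
  have e2: "\<bar>of_int A * e2\<bar> \<le> c * W"
    using P2 L1 Q s s_less W r1 unfolding e2_def
    by (intro scaled_product_bound[of _ Q1 s _ Q2]) (auto simp: point_def line_def Q1_def Q2_def)
  have f1: "\<bar>of_int B * f1\<bar> \<le> c * 1"
    using P1 L1 Q t t_le unfolding f1_def Q1_def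
    by (intro scaled_product_bound[of _ "of_int q1" t _ "of_int q1"]) (auto simp: point_def line_def)
  have f2: "\<bar>of_int B * f2\<bar> \<le> c * W"
    using P2 L1 Q t t_le W r1 unfolding f2_def
    by (intro scaled_product_bound[of _ Q1 t _ Q2]) (auto simp: point_def line_def Q1_def Q2_def)
  have C: "of_int C * Q1 = - (of_int A * of_int p1 + of_int B * of_int r1)"
    using line_real[OF L1] by (simp add: Q1_def)
  have "Q1 * of_int N = Q1 * (of_int A * of_int p2 + of_int B * of_int r2) + (of_int C * Q1) * Q2"
    by (simp add: N_def Q2_def algebra_simps)
  \<comment> \<open>The equation of the first point eliminates \<open>C\<close>; what remains are
    the four approximation errors and the distance between \<open>x1\<close> and
    \<open>x2\<close>.\<close>
  also have "\<dots> = Q2 * (of_int A * e1) - Q1 * (of_int A * e2)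
      + (Q2 * (of_int B * f1) - Q1 * (of_int B * f2)) + Q1 * (Q2 * of_int B * (x2 - x1))"
    unfolding C e1_def e2_def f1_def f2_def by (simp add: algebra_simps)
  finally have "\<bar>Q1 * of_int N\<bar> \<le> \<bar>Q2 * (of_int A * e1)\<bar> + \<bar>Q1 * (of_int A * e2)\<bar>
      + (\<bar>Q2 * (of_int B * f1)\<bar> + \<bar>Q1 * (of_int B * f2)\<bar>) + \<bar>Q1 * (Q2 * of_int B * (x2 - x1))\<bar>"
    by linarith
  also have "\<dots> = Q2 * \<bar>of_int A * e1\<bar> + Q1 * \<bar>of_int A * e2\<bar>
      + (Q2 * \<bar>of_int B * f1\<bar> + Q1 * \<bar>of_int B * f2\<bar>) + Q1 * (Q2 * of_int B * \<bar>x1 - x2\<bar>)"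
    using Q Bpos by (simp add: abs_mult abs_minus_commute)
  also have "\<dots> \<le> (W * Q1) * (c * 1) + Q1 * (c * W)
      + ((W * Q1) * (c * 1) + Q1 * (c * W)) + Q1 * ((W * Q1) * of_int B * (2 * \<rho> / R ^ n))"
    using e1 e2 f1 f2 r1 Q Bpos W R \<rho> x
    by (intro add_mono mult_mono) auto
  also have "\<dots> = Q1 * (4 * c * W + W * (2 * \<rho> / R ^ n) * (Q1 * of_int B))"
    by (simp add: algebra_simps)
  finally have "Q1 * \<bar>of_int N\<bar> \<le> Q1 * (4 * c * W + W * (2 * \<rho> / R ^ n) * (Q1 * of_int B))"
    using Q by (simp add: abs_mult)
  then have "\<bar>of_int N\<bar> \<le> 4 * c * W + W * (2 * \<rho> / R ^ n) * (Q1 * of_int B)" using Q by simp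
  also have "\<dots> < 4 * c * W + W * (2 * \<rho> / R ^ n) * h (Suc n)"
    using l1 W R \<rho> by (intro add_strict_left_mono mult_strict_left_mono) (auto simp: level_def Q1_def)
  also have "\<dots> = 4 * c * W + 2 * c1 * (R * W)" using R \<rho> by (simp add: h_def)
  also have "\<dots> \<le> 4 * c1 * (R * W) + 2 * c1 * (R * W)"
  proof -
    have "c * W \<le> c1 * (R * W)"
      using c_le c1 R W c_pos by (intro mult_mono) auto
    then show ?thesis by linarith
  qed
  \<comment> \<open>This is the origin of the third bound imposed on \<open>c1\<close>. Strictness
    comes from the strict upper bound on q B in \<open>level\<close>.\<close>
  also have "\<dots> = 6 * c1 * R ^ (K + 2)" by (simp add: W_def)
  also have "\<dots> \<le> 1" by (rule c1)
  finally have "\<bar>N\<bar> < 1" by linarith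
  then show ?thesis by (simp add: N_def)
qed

text \<open>By \<open>point_on_line\<close> both rational points lie on both lines. If the points
  are distinct, the lines coincide. If they are the same point, each height is within
  \<open>c / h n\<close> of its ordinate.\<close>

lemma heights_near_level_0:
  assumes P1: "point x1 p1 r1 q1" and L1: "line p1 r1 q1 A1 B1 C1" and l1: "level n 0 q1 B1"
    and P2: "point x2 p2 r2 q2" and L2: "line p2 r2 q2 A2 B2 C2" and l2: "level n 0 q2 B2"
    and x: "\<bar>x1 - x2\<bar> \<le> 2 * \<rho> / R ^ n"
  shows "\<bar>height A1 B1 C1 - height A2 B2 C2\<bar> * h n \<le> 2 * c"
proof -
  define y1 y2 where "y1 = height A1 B1 C1" and "y2 = height A2 B2 C2"
  define Q1 Q2 where "Q1 = real_of_int q1" and "Q2 = real_of_int q2"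
  have Q: "0 < Q1" "0 < Q2" using P1 P2 by (auto simp: Q1_def Q2_def point_def)
  have B: "0 < real_of_int B1" "0 < real_of_int B2" using L1 L2 by (auto simp: line_def)
  have L12: "real_of_int A1 * of_int p2 + of_int B1 * of_int r2 + of_int C1 * Q2 = 0"
    using point_on_line[OF P1 L1 l1 P2 L2 l2 x] unfolding Q2_def
    by (metis of_int_0 of_int_add of_int_mult)
  have L21: "real_of_int A2 * of_int p1 + of_int B2 * of_int r1 + of_int C2 * Q1 = 0"
    using point_on_line[OF P2 L2 l2 P1 L1 l1] x unfolding Q1_def abs_minus_commute[of x1]
    by (metis of_int_0 of_int_add of_int_mult)
  have L11: "real_of_int A1 * of_int p1 + of_int B1 * of_int r1 + of_int C1 * Q1 = 0"
    using line_real[OF L1] by (simp add: Q1_def)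
  have L22: "real_of_int A2 * of_int p2 + of_int B2 * of_int r2 + of_int C2 * Q2 = 0"
    using line_real[OF L2] by (simp add: Q2_def)
  define u v where "u = of_int p2 * Q1 - of_int p1 * Q2" and "v = of_int r2 * Q1 - of_int r1 * Q2"
  have uv1: "of_int A1 * u + of_int B1 * v = 0"
  proof -
    have "of_int A1 * u + of_int B1 * v = Q1 * (of_int A1 * of_int p2 + of_int B1 * of_int r2 + of_int C1 * Q2)
       - Q2 * (of_int A1 * of_int p1 + of_int B1 * of_int r1 + of_int C1 * Q1)"
      by (simp add: u_def v_def algebra_simps)
    then show ?thesis using L12 L11 by simp
  qed
  have uv2: "of_int A2 * u + of_int B2 * v = 0"
  proof -
    have "of_int A2 * u + of_int B2 * v = Q1 * (of_int A2 * of_int p2 + of_int B2 * of_int r2 + of_int C2 * Q2)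
       - Q2 * (of_int A2 * of_int p1 + of_int B2 * of_int r1 + of_int C2 * Q1)"
      by (simp add: u_def v_def algebra_simps)
    then show ?thesis using L22 L21 by simp
  qed
  have y: "of_int A1 * \<theta> + of_int B1 * y1 + of_int C1 = 0" "of_int A2 * \<theta> + of_int B2 * y2 + of_int C2 = 0"
    using height_eq L1 L2 by (auto simp: y1_def y2_def line_def)
  have "\<bar>y1 - y2\<bar> * h n \<le> 2 * c"
  proof (cases "u = 0")
    case True
    then have "v = 0" using uv1 B by simp
    then have eq: "of_int r1 / Q1 = of_int r2 / Q2" using Q by (simp add: v_def field_simps)
    have "\<bar>of_int r1 / Q1 - y1\<bar> * h n \<le> \<bar>of_int r1 / Q1 - y1\<bar> * (Q1 * of_int B1)"
      using l1 by (intro mult_left_mono) (auto simp: level_def Q1_def)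
    also have "\<dots> \<le> c" using height_near(2)[OF P1 L1] by (simp add: Q1_def y1_def)
    finally have 1: "\<bar>of_int r1 / Q1 - y1\<bar> * h n \<le> c" .
    have "\<bar>of_int r2 / Q2 - y2\<bar> * h n \<le> \<bar>of_int r2 / Q2 - y2\<bar> * (Q2 * of_int B2)"
      using l2 by (intro mult_left_mono) (auto simp: level_def Q2_def)
    also have "\<dots> \<le> c" using height_near(2)[OF P2 L2] by (simp add: Q2_def y2_def)
    finally have 2: "\<bar>of_int r2 / Q2 - y2\<bar> * h n \<le> c" .
    have "\<bar>y1 - y2\<bar> * h n \<le> (\<bar>of_int r1 / Q1 - y1\<bar> + \<bar>of_int r2 / Q2 - y2\<bar>) * h n"
      using h_pos[of n] eq by (intro mult_right_mono) auto
    then show ?thesis using 1 2 by (simp add: distrib_right)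
  next
    case False
    have "of_int A1 * of_int B2 * u = of_int A2 * of_int B1 * u"
      using uv1 uv2 by algebra
    then have par: "of_int A1 * of_int B2 = of_int A2 * (of_int B1 :: real)" using False by simp
    have "Q1 * of_int B1 * of_int B2 * (y1 - y2) = 0"
      using par y L11 L21 by algebra
    then have "y1 = y2" using Q B by simp
    then show ?thesis using c_pos by simp
  qed
  then show ?thesis by (simp add: y1_def y2_def)
qed

text \<open>Two different lines of level \<open>k > 0\<close> meet in a rational point of such a small
  denominator that its zone has been avoided already.\<close>
lemma heights_eq_level_pos:
  assumes P1: "point x1 p1 r1 q1" and L1: "line p1 r1 q1 A1 B1 C1" and l1: "level (j + k) k q1 B1"
    and P2: "point x2 p2 r2 q2" and L2: "line p2 r2 q2 A2 B2 C2" and l2: "level (j + k) k q2 B2"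
    and x: "\<bar>x1 - x2\<bar> \<le> 2 * \<rho> / R ^ j" and k: "1 \<le> k"
    and avoid: "\<And>n k'. \<lbrakk>2 * k' \<le> n; n + M \<le> j\<rbrakk> \<Longrightarrow> x1 \<notin> zone n k'"
  shows "height A1 B1 C1 = height A2 B2 C2"
proof -
  define y1 y2 where "y1 = height A1 B1 C1" and "y2 = height A2 B2 C2"
  \<comment> \<open>\<open>V\<close> will bound the denominators, V^s the coefficients
    \<open>A\<close>, and V^t / G the coefficients \<open>B\<close>. \<open>d\<close> equals 6
    \<rho> / R^j, rewritten so that the powers of \<open>V\<close> cancel. The exponent of
    \<open>G\<close> is one less than in \<open>level\<close>, to absorb the factor \<open>R\<close>
    between \<open>h (j + k)\<close> and \<open>h (Suc (j + k))\<close>.\<close>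
  define X where "X = h (Suc (j + k)) * R ^ (K + l * k)"
  define V where "V = X powr (1 / (1 + t))"
  define G where "G = R ^ (K + l * (k - 1) - 1)"
  define T where "T = 6 * c1 * R ^ (k + l + 2)"
  define d where "d = T * G / X"
  have G1: "1 \<le> G" using R by (auto simp: G_def intro!: one_le_power)
  have GR: "R ^ (K + l * k) = G * R ^ (l + 1)"
  proof -
    have "l * k = l * (k - 1) + l" using k by (cases k) auto
    then have "K + l * k = (K + l * (k - 1) - 1) + (l + 1)" using l by linarith
    then show ?thesis unfolding G_def by (metis power_add)
  qed
  have Tpos: "0 < T" using c1 R by (simp add: T_def)
  have Xpos: "0 < X" using h_pos R by (simp add: X_def)
  \<comment> \<open>The 96 in \<open>gap\<close> is 4 * 6 * 4: the 4 here, the 6 in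
    \<open>T\<close>, and the 4 dividing \<open>\<eta> * c1\<close> in \<open>c\<close>.\<close>
  have GT: "4 * T < c * G powr t"
  proof -
    have "96 * R ^ (k + l + 2) \<le> 96 * R ^ (k + l + M + 2)"
      using R by (intro mult_left_mono power_increasing) auto
    also have "\<dots> < \<eta> * G powr t" using gap[OF k] by (simp add: G_def)
    finally have "c1 / 4 * (96 * R ^ (k + l + 2)) < c1 / 4 * (\<eta> * G powr t)"
      using c1 by (intro mult_strict_left_mono) auto
    then show ?thesis by (simp add: T_def c mult_ac)
  qed
  have Gt: "G powr t \<le> G" using powr_mono[of t 1 G] t_le G1 by simp
  \<comment> \<open>The bound on q^(1 + t) follows from the upper bounds in \<open>level\<close>.
    The bound on \<open>B\<close> needs q \<ge> V / R^(l + 1), which uses the lower bounds,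
    available because \<open>k\<close> is positive.\<close>
  have bounds: "real_of_int q \<le> V \<and> \<bar>real_of_int A\<bar> \<le> V powr s \<and> real_of_int B \<le> V powr t / G \<and> 1 \<le> V \<and> V powr (1 + t) = X"
    if "point x p r q" "line p r q A B C" and lv: "level (j + k) k q B" for x p r q A B C
  proof -
    have q: "1 \<le> real_of_int q" and B: "1 \<le> real_of_int B" using that by (auto simp: point_def line_def)
    have VX: "V powr (1 + t) = X" using t Xpos by (simp add: V_def powr_powr)
    have Vpos: "0 < V" using Xpos by (simp add: V_def)
    have "of_int q powr (1 + t) = of_int q * of_int q powr t" using q by (simp add: powr_add)
    also have "\<dots> \<le> of_int q * (R ^ (K + l * k) * of_int B)"
      using lv q by (intro mult_left_mono) (auto simp: level_def)
    also have "\<dots> = R ^ (K + l * k) * (of_int q * of_int B)" by simp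
    also have "\<dots> \<le> R ^ (K + l * k) * h (Suc (j + k))"
      using lv R by (intro mult_left_mono) (auto simp: level_def)
    also have "\<dots> = V powr (1 + t)" by (simp add: X_def VX)
    finally have qV: "real_of_int q \<le> V"
      by (rule powr_le_imp_le) (use t Vpos in auto)
    have "V powr (1 + t) = R ^ (l + 1) * (R ^ (K + l * (k - 1)) * h (j + k))"
    proof -
      have "G * R = R ^ (K + l * (k - 1))" unfolding G_def using l by (metis power_minus_mult add_pos_nonneg le_0_eq less_eq_nat.simps(1) not_gr_zero not_numeral_le_zero order.trans trans_le_add1)
      then show ?thesis unfolding VX X_def GR by (simp add: h_def)
    qed
    also have "\<dots> \<le> R ^ (l + 1) * (R ^ (K + l * (k - 1)) * (of_int q * of_int B))"
      using lv R by (intro mult_left_mono) (auto simp: level_def)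
    also have "\<dots> = R ^ (l + 1) * (of_int q * (R ^ (K + l * (k - 1)) * of_int B))" by simp
    also have "\<dots> \<le> R ^ (l + 1) * (of_int q * of_int q powr t)"
      using lv R q k by (intro mult_left_mono) (auto simp: level_def)
    also have "\<dots> = R ^ (l + 1) * of_int q powr (1 + t)" using q by (simp add: powr_add)
    also have "\<dots> \<le> (R ^ (l + 1)) powr (1 + t) * of_int q powr (1 + t)"
    proof -
      have "1 \<le> R ^ (l + 1)" using R by (intro one_le_power) auto
      then have "R ^ (l + 1) \<le> (R ^ (l + 1)) powr (1 + t)"
        using powr_mono[of 1 "1 + t" "R ^ (l + 1)"] t by simp
      then show ?thesis by (intro mult_right_mono) auto
    qed
    also have "\<dots> = (R ^ (l + 1) * of_int q) powr (1 + t)" using R q by (simp add: powr_mult)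
    finally have Vq: "V \<le> R ^ (l + 1) * of_int q"
      by (rule powr_le_imp_le) (use t q R in auto)
    have "of_int B * V \<le> of_int B * (R ^ (l + 1) * of_int q)"
      using Vq B by (intro mult_left_mono) auto
    also have "\<dots> = R ^ (l + 1) * (of_int q * of_int B)" by simp
    also have "\<dots> \<le> R ^ (l + 1) * h (Suc (j + k))" using lv R by (intro mult_left_mono) (auto simp: level_def)
    also have "\<dots> = X / G" using G1 by (simp add: X_def GR)
    also have "\<dots> = V powr t / G * V" unfolding VX[symmetric] powr_add using Vpos by simp
    finally have "of_int B \<le> V powr t / G" using Vpos by (rule mult_right_le_imp_le)
    moreover have "of_int q powr s \<le> V powr s" using qV q s by (intro powr_mono2) auto
    moreover have "\<bar>real_of_int A\<bar> \<le> of_int q powr s" using that(2) by (simp add: line_def)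
    ultimately show ?thesis using qV q VX by auto
  qed
  note b1 = bounds[OF P1 L1 l1] and b2 = bounds[OF P2 L2 l2]
  have V1: "1 \<le> V" and VX: "V powr (1 + t) = X" using b1 by auto
  define a b where "a = V powr s" and "b = V powr t / G"
  have a0: "0 < a" and b0: "0 < b" using V1 G1 by (auto simp: a_def b_def)
  have Aa: "\<bar>real_of_int A1\<bar> \<le> a" "\<bar>real_of_int A2\<bar> \<le> a"
    and Bb: "real_of_int B1 \<le> b" "real_of_int B2 \<le> b"
    using b1 b2 by (auto simp: a_def b_def)
  have ab: "a * b = V / G" using V1 st by (simp add: a_def b_def flip: powr_add)
  have B: "0 < real_of_int B1" "0 < real_of_int B2" using L1 L2 by (auto simp: line_def)
  have d: "d = 6 * (\<rho> / R ^ j)"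
  proof -
    have "X = h (Suc (j + k)) * (G * R ^ (l + 1))" by (simp add: X_def GR)
    also have "\<dots> = c1 / \<rho> * R ^ j * (R ^ (k + l + 2) * G)" by (simp add: h_def power_add)
    finally have "d = T * G / (c1 / \<rho> * R ^ j * (R ^ (k + l + 2) * G))" by (simp add: d_def)
    also have "\<dots> = 6 * (\<rho> / R ^ j)" using c1 R \<rho> G1 by (simp add: T_def)
    finally show ?thesis .
  qed
  have near: "\<bar>x - height A B C\<bar> \<le> 2 * (\<rho> / R ^ j)"
    if "point x p r q" "line p r q A B C" and lv: "level (j + k) k q B" for x p r q A B C
  proof -
    have "\<bar>x - height A B C\<bar> * h j \<le> \<bar>x - height A B C\<bar> * (of_int q * of_int B)"
      using lv h_mono[of j "j + k"] by (intro mult_left_mono) (auto simp: level_def)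
    also have "\<dots> \<le> 2 * c" by (rule height_near[OF that(1,2)])
    also have "\<dots> \<le> 2 * c1" using c_le c1 by simp
    finally have "\<bar>x - height A B C\<bar> \<le> 2 * c1 / h j" using h_pos[of j] by (simp add: field_simps)
    also have "\<dots> = 2 * (\<rho> / R ^ j)" using c1 \<rho> by (simp add: h_def)
    finally show ?thesis .
  qed
  have n1: "\<bar>x1 - y1\<bar> \<le> 2 * (\<rho> / R ^ j)" and n2: "\<bar>x2 - y2\<bar> \<le> 2 * (\<rho> / R ^ j)"
    unfolding y1_def y2_def by (rule near[OF P1 L1 l1], rule near[OF P2 L2 l2])
  have x': "\<bar>x1 - x2\<bar> \<le> 2 * (\<rho> / R ^ j)" using x by simp
  have rpos: "0 \<le> \<rho> / R ^ j" using \<rho> R by simp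
  have xy1: "\<bar>x1 - y1\<bar> \<le> d" and xy2: "\<bar>x1 - y2\<bar> \<le> d" and yy: "\<bar>y1 - y2\<bar> \<le> d"
    unfolding d using n1 n2 x' rpos by linarith+
  have d0: "0 \<le> d" unfolding d using rpos by simp
  have y: "of_int A1 * \<theta> + of_int B1 * y1 + of_int C1 = 0" "of_int A2 * \<theta> + of_int B2 * y2 + of_int C2 = 0"
    using height_eq L1 L2 by (auto simp: y1_def y2_def line_def)
  \<comment> \<open>Cramer's rule: the lines meet in \<open>(p0 / D, r0 / D)\<close>. The identities
    below express the errors of this point at \<theta> and \<open>x1\<close> through distances of at
    most \<open>d\<close>.\<close>
  define D where "D = A1 * B2 - A2 * B1"
  define p0 where "p0 = B1 * C2 - B2 * C1"
  define r0 where "r0 = A2 * C1 - A1 * C2"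
  have Dth: "of_int D * \<theta> - of_int p0 = - (of_int B1 * of_int B2 * (y1 - y2))"
    using y unfolding D_def p0_def of_int_diff of_int_mult by algebra
  have Dx: "of_int D * x1 - of_int r0 = of_int A1 * of_int B2 * (x1 - y2) - of_int A2 * of_int B1 * (x1 - y1)"
    using y unfolding D_def r0_def of_int_diff of_int_mult by algebra
  have BB: "\<bar>of_int B1 * of_int B2 * (y1 - y2)\<bar> \<le> b * b * d"
    using Bb B yy b0 d0 unfolding abs_mult by (intro mult_mono) auto
  have AB1: "\<bar>of_int A1 * of_int B2 * (x1 - y2)\<bar> \<le> a * b * d"
    using Aa Bb B xy2 a0 b0 d0 unfolding abs_mult by (intro mult_mono) auto
  have AB2: "\<bar>of_int A2 * of_int B1 * (x1 - y1)\<bar> \<le> a * b * d"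
    using Aa Bb B xy1 a0 b0 d0 unfolding abs_mult by (intro mult_mono) auto
  have Dle: "\<bar>of_int D\<bar> \<le> 2 * (V / G)"
  proof -
    have "\<bar>real_of_int A1 * of_int B2\<bar> \<le> a * b" "\<bar>real_of_int A2 * of_int B1\<bar> \<le> a * b"
      using Aa Bb B a0 b0 unfolding abs_mult by (intro mult_mono; simp)+
    then show ?thesis unfolding D_def of_int_diff of_int_mult ab by linarith
  qed
  have bbd: "b * b * d = V powr (- s) * T / G"
  proof -
    have "b * b * d = (V powr t * V powr t / V powr (1 + t)) * T / G"
      using G1 unfolding b_def d_def VX[symmetric] by (simp add: field_simps)
    also have "V powr t * V powr t / V powr (1 + t) = V powr (- s)"
    proof -
      have "t + t - (1 + t) = - s" using st by simp
      then show ?thesis unfolding powr_add[symmetric] powr_diff[symmetric] by simp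
    qed
    finally show ?thesis .
  qed
  have TG0: "0 \<le> T / G" using Tpos G1 by simp
  have TG: "2 * (T / G) < c"
  proof -
    have "4 * T < c * G" using GT mult_left_mono[OF Gt, of c] c_pos by linarith
    then have "4 * (T / G) < c" using G1 by (simp add: field_simps)
    then show ?thesis using TG0 by linarith
  qed
  have "y1 = y2"
  proof (cases "D = 0")
    \<comment> \<open>Parallel lines: \<open>p0\<close> is an integer of absolute value below 1,
      hence 0.\<close>
    case True
    have "\<bar>real_of_int p0\<bar> \<le> b * b * d"
      using BB Dth True by simp
    also have "\<dots> \<le> 1 * (T / G)"
      unfolding bbd times_divide_eq_right[symmetric] using V1 s Tpos G1
      by (intro mult_right_mono) (auto simp: powr_minus intro!: inverse_le_1_iff[THEN iffD2] ge_one_powr_ge_zero)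
    also have "\<dots> < 1" using TG TG0 c_le c1_le c1(1) by linarith
    finally have "p0 = 0" by linarith
    then have "of_int B1 * of_int B2 * (y1 - y2) = 0" using Dth True by simp
    then show ?thesis using B by simp
  next
    \<comment> \<open>The intersection point approximates \<open>(\<theta>, x1)\<close> well enough
      to put \<open>x1\<close> into some zone. Its denominator is at most 2 V / G, so by
      \<open>gap\<close> the index of that zone is more than \<open>M\<close> below
      \<open>j\<close>, and the zone has been avoided already. The factor \<open>sgn D\<close> makes
      the denominator positive.\<close>
    case False
    define q0 where "q0 = \<bar>D\<bar>"
    have q0: "1 \<le> real_of_int q0" "real_of_int q0 \<le> 2 * (V / G)"
      using False Dle by (auto simp: q0_def)
    have VG: "0 \<le> V / G" using V1 G1 by simp
    have th: "\<bar>of_int q0 * \<theta> - of_int (sgn D * p0)\<bar> \<le> b * b * d"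
    proof -
      have "of_int q0 * \<theta> - of_int (sgn D * p0) = of_int (sgn D) * (of_int D * \<theta> - of_int p0)"
        by (simp add: q0_def sgn_if abs_if algebra_simps)
      then have "\<bar>of_int q0 * \<theta> - of_int (sgn D * p0)\<bar> = \<bar>of_int D * \<theta> - of_int p0\<bar>"
        using False by (simp add: abs_mult sgn_if)
      then show ?thesis using BB Dth by simp
    qed
    have xx: "\<bar>of_int q0 * x1 - of_int (sgn D * r0)\<bar> \<le> 2 * (V / G) * d"
    proof -
      have "of_int q0 * x1 - of_int (sgn D * r0) = of_int (sgn D) * (of_int D * x1 - of_int r0)"
        by (simp add: q0_def sgn_if abs_if algebra_simps)
      then have "\<bar>of_int q0 * x1 - of_int (sgn D * r0)\<bar> = \<bar>of_int D * x1 - of_int r0\<bar>"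
        using False by (simp add: abs_mult sgn_if)
      then show ?thesis using AB1 AB2 Dx unfolding ab by linarith
    qed
    have "point x1 (sgn D * p0) (sgn D * r0) q0"
      unfolding point_def
    proof (intro conjI)
      show "0 < q0" using False by (simp add: q0_def)
      have "of_int q0 powr s \<le> (2 * V) powr s"
      proof (rule powr_mono2)
        have "V / G \<le> V" using V1 G1 by (simp add: field_simps)
        then show "real_of_int q0 \<le> 2 * V" using q0 by linarith
      qed (use s q0 in auto)
      also have "\<dots> = 2 powr s * V powr s" using V1 by (simp add: powr_mult)
      also have "\<dots> \<le> 2 * V powr s"
        using s_less powr_mono[of s 1 2] by (intro mult_right_mono) auto
      finally have "\<bar>of_int q0 * \<theta> - of_int (sgn D * p0)\<bar> * of_int q0 powr s \<le> (b * b * d) * (2 * V powr s)"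
        using th b0 d0 by (intro mult_mono) auto
      also have "\<dots> = 2 * (T / G) * (V powr (- s) * V powr s)" unfolding bbd by simp
      also have "\<dots> = 2 * (T / G)" using V1 by (simp flip: powr_add)
      also have "\<dots> < c" by (rule TG)
      finally show "\<bar>of_int q0 * \<theta> - of_int (sgn D * p0)\<bar> * of_int q0 powr s < c" .
      have "of_int q0 powr t \<le> (2 * (V / G)) powr t"
        using q0 t by (intro powr_mono2) auto
      also have "\<dots> = 2 powr t * (V / G) powr t" using VG by (subst powr_mult) auto
      also have "\<dots> \<le> 2 * (V / G) powr t"
        using t_le powr_mono[of t 1 2] by (intro mult_right_mono) auto
      finally have "\<bar>of_int q0 * x1 - of_int (sgn D * r0)\<bar> * of_int q0 powr t
          \<le> (2 * (V / G) * d) * (2 * (V / G) powr t)"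
        using xx VG d0 by (intro mult_mono) auto
      also have "\<dots> = 4 * (V powr t * V) * T / (G powr t * X)"
        using V1 G1 by (simp add: powr_divide d_def mult_ac)
      also have "V powr t * V = X" unfolding VX[symmetric] powr_add using V1 by simp
      also have "4 * X * T / (G powr t * X) = 4 * T / G powr t" using Xpos by simp
      also have "\<dots> < c" using GT G1 by (simp add: field_simps)
      finally show "\<bar>of_int q0 * x1 - of_int (sgn D * r0)\<bar> * of_int q0 powr t < c" .
    qed
    then obtain n k' where nk: "2 * k' \<le> n" "x1 \<in> zone n k'" "h n \<le> of_int q0 powr (1 + t)"
      using zone_ex by blast
    then have "j \<le> n + M" using avoid[of k' n] by (meson nat_le_linear)
    then have "h j \<le> h (n + M)" by (rule h_mono)
    also have "\<dots> = h n * R ^ M" by (simp add: h_def power_add)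
    also have "\<dots> \<le> of_int q0 powr (1 + t) * R ^ M" using nk R by (intro mult_right_mono) auto
    also have "\<dots> \<le> (4 * X / (G * G powr t)) * R ^ M"
    proof (rule mult_right_mono)
      have "of_int q0 powr (1 + t) \<le> (2 * (V / G)) powr (1 + t)"
        using q0 t by (intro powr_mono2) auto
      also have "\<dots> = 2 powr (1 + t) * (V / G) powr (1 + t)" using VG by (subst powr_mult) auto
      also have "\<dots> \<le> 2 powr 2 * (V / G) powr (1 + t)"
        using t_le by (intro mult_right_mono powr_mono) auto
      also have "\<dots> = 4 * X / (G * G powr t)"
        using V1 G1 VX by (simp add: powr_divide powr_add)
      finally show "of_int q0 powr (1 + t) \<le> 4 * X / (G * G powr t)" .
    qed (use R in auto)
    also have "\<dots> < X / (G * R ^ (k + l + 2))"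
    proof -
      have "4 * R ^ (k + l + M + 2) < G powr t"
      proof -
        have "\<eta> * G powr t \<le> 1 * G powr t" using \<eta> by (intro mult_right_mono) auto
        moreover have "0 < R ^ (k + l + M + 2)" using R by simp
        ultimately show ?thesis using gap[OF k] unfolding G_def by linarith
      qed
      then have "X / G * (4 * R ^ (k + l + M + 2)) < X / G * G powr t"
        using Xpos G1 by (intro mult_strict_left_mono) auto
      then show ?thesis using R G1 by (simp add: field_simps power_add)
    qed
    also have "\<dots> = h j"
      unfolding X_def GR using R G1 by (simp add: h_def power_add)
    finally show ?thesis by simp
  qed
  then show ?thesis by (simp add: y1_def y2_def)
qed

text \<open>All heights in the group differ from that of one fixed line by at most
  \<open>2 * c / h (j + k)\<close>, and every point is equally close to the height of its own line.
  The choice of \<open>c\<close> turns the total \<open>4 * c\<close> into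
  \<open>\<eta> * c1\<close>.\<close>

lemma zone_cover:
  assumes I: "snd I = \<rho> / R ^ j"
    and avoid: "\<And>n k'. \<lbrakk>2 * k' \<le> n; n + M \<le> j\<rbrakk> \<Longrightarrow> ball_of I \<inter> zone n k' = {}"
  shows "\<exists>y. zone (j + k) k \<inter> ball_of I \<subseteq> cball y (\<eta> * \<rho> / R ^ (j + k))"
proof (cases "zone (j + k) k \<inter> ball_of I = {}")
  case False
  then obtain x1 where x1: "x1 \<in> zone (j + k) k" "x1 \<in> ball_of I" by blast
  then obtain p1 r1 q1 A1 B1 C1 where 1: "point x1 p1 r1 q1" "line p1 r1 q1 A1 B1 C1" "level (j + k) k q1 B1"
    unfolding zone_def by blast
  have "x2 \<in> cball (height A1 B1 C1) (\<eta> * \<rho> / R ^ (j + k))" if x2: "x2 \<in> zone (j + k) k" "x2 \<in> ball_of I" for x2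
  proof -
    obtain p2 r2 q2 A2 B2 C2 where 2: "point x2 p2 r2 q2" "line p2 r2 q2 A2 B2 C2" "level (j + k) k q2 B2"
      using x2 unfolding zone_def by blast
    have dist: "\<bar>x1 - x2\<bar> \<le> 2 * \<rho> / R ^ j"
    proof -
      have "\<bar>fst I - x1\<bar> \<le> \<rho> / R ^ j" "\<bar>fst I - x2\<bar> \<le> \<rho> / R ^ j"
        using x1 x2 I by (auto simp: ball_of_def dist_real_def)
      then show ?thesis by linarith
    qed
    have yy: "\<bar>height A1 B1 C1 - height A2 B2 C2\<bar> * h (j + k) \<le> 2 * c"
    proof (cases "k = 0")
      case True
      then show ?thesis using heights_near_level_0[of x1 p1 r1 q1 A1 B1 C1 j x2] 1 2 dist by simp
    next
      case False
      then have "height A1 B1 C1 = height A2 B2 C2"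
        using heights_eq_level_pos[OF 1 2 dist] avoid x1 by (metis IntI emptyE less_one not_le)
      then show ?thesis using c_pos by simp
    qed
    have xy: "\<bar>x2 - height A2 B2 C2\<bar> * h (j + k) \<le> 2 * c"
    proof -
      have "\<bar>x2 - height A2 B2 C2\<bar> * h (j + k) \<le> \<bar>x2 - height A2 B2 C2\<bar> * (of_int q2 * of_int B2)"
        using 2(3) by (intro mult_left_mono) (auto simp: level_def)
      also have "\<dots> \<le> 2 * c" by (rule height_near[OF 2(1,2)])
      finally show ?thesis .
    qed
    have "\<bar>height A1 B1 C1 - x2\<bar> * h (j + k) \<le>
        (\<bar>height A1 B1 C1 - height A2 B2 C2\<bar> + \<bar>x2 - height A2 B2 C2\<bar>) * h (j + k)"
      using h_pos[of "j + k"] by (intro mult_right_mono) auto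
    also have "\<dots> \<le> \<eta> * c1" using yy xy unfolding c by (simp add: distrib_right)
    finally have "\<bar>height A1 B1 C1 - x2\<bar> \<le> \<eta> * c1 / h (j + k)"
      using h_pos[of "j + k"] by (simp add: field_simps)
    also have "\<dots> = \<eta> * \<rho> / R ^ (j + k)" using c1 by (simp add: h_def)
    finally show ?thesis by (simp add: dist_real_def)
  qed
  then show ?thesis by blast
qed auto

end

section \<open>The winning strategy\<close>

lemma dist_int_le: "dist_int x \<le> \<bar>x - of_int k\<bar>"
  unfolding dist_int_def by (rule cINF_lower) (auto intro!: bdd_belowI[of _ 0])

lemma dist_int_nonneg: "0 \<le> dist_int x"
  unfolding dist_int_def by (rule cINF_greatest) auto

lemma dist_int_lessE:
  assumes "dist_int x < e"
  obtains k :: int where "\<bar>x - of_int k\<bar> < e"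
  using assms unfolding dist_int_def
  by (subst (asm) cINF_less_iff) (auto intro!: bdd_belowI[of _ 0])

lemma Bad_fibreI:
  assumes "0 < c"
    and "\<And>q. 1 \<le> q \<Longrightarrow> c \<le> max (real q powr s * dist_int (real q * \<theta>)) (real q powr t * dist_int (real q * y))"
  shows "y \<in> Bad_fibre s t \<theta>"
proof -
  have "c \<le> (INF q\<in>{1::nat..}. max (real q powr s * dist_int (real q * \<theta>)) (real q powr t * dist_int (real q * y)))"
    using assms(2) by (intro cINF_greatest) auto
  then show ?thesis using assms(1) by (auto simp: Bad_fibre_def Bad_def)
qed

text \<open>Once t l \<ge> 1, raising \<open>k\<close> by one multiplies the right side by at least
  \<open>R\<close>, just as the left. It remains to make \<open>K\<close> large enough for
  \<open>k = 1\<close>.\<close>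

lemma exists_gap_exponent:
  fixes R \<eta> t :: real
  assumes "1 < R" "0 < \<eta>" "0 < t"
  shows "\<exists>l K :: nat. 2 \<le> l \<and> l \<le> K \<and>
    (\<forall>k\<ge>1. 96 * R ^ (k + l + M + 2) < \<eta> * (R ^ (K + l * (k - 1) - 1)) powr t)"
proof -
  obtain l0 :: nat where "1 / t < real l0" using reals_Archimedean2 by blast
  define l where "l = l0 + 2"
  have l: "1 \<le> t * real l"
    using \<open>1 / t < real l0\<close> assms by (simp add: l_def field_simps)
  have Rt: "1 < R powr t" using assms by simp
  obtain m where m: "96 * R ^ (l + M + 3) / \<eta> < (R powr t) ^ m" using real_arch_pow[OF Rt] by blast
  define K where "K = l + m + 1"
  have "96 * R ^ (k + l + M + 2) < \<eta> * (R ^ (K + l * (k - 1) - 1)) powr t" if "1 \<le> k" for k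
  proof -
    obtain i where k: "k = Suc i" using \<open>1 \<le> k\<close> by (cases k) auto
    have "96 * R ^ (l + M + 3) * R ^ i < (\<eta> * (R powr t) ^ m) * R ^ i"
      using m assms by (intro mult_strict_right_mono) (auto simp: field_simps)
    also have "\<dots> = \<eta> * R powr (t * real m + real i)"
      using assms by (simp add: powr_add powr_powr flip: powr_realpow)
    also have "\<dots> \<le> \<eta> * R powr (t * real (l + m + l * i))"
    proof -
      have "0 \<le> t * real l" using assms by simp
      moreover have "1 * real i \<le> (t * real l) * real i" using l by (intro mult_right_mono) auto
      ultimately have "t * real m + real i \<le> t * real (l + m + l * i)"
        by (simp add: algebra_simps)
      then show ?thesis using assms by (intro mult_left_mono powr_mono) auto
    qed
    also have "\<dots> = \<eta> * (R ^ (K + l * (k - 1) - 1)) powr t"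
      using assms by (simp add: k K_def powr_powr mult.commute flip: powr_realpow)
    finally show ?thesis by (simp add: k power_add mult_ac eval_nat_numeral)
  qed
  moreover have "2 \<le> l" "l \<le> K" by (simp_all add: K_def l_def)
  ultimately show ?thesis by blast
qed

theorem theorem1p2:
  fixes s t \<theta> :: real
  assumes "s \<ge> 0" and "t \<ge> 0" and "s + t = 1"
    and "s = 0 \<or> (INF q\<in>{1::nat..}. real q powr (1 / s) * dist_int (real q * \<theta>)) > 0"
  shows "alpha_winning (1/2) (Bad_fibre s t \<theta>)"
proof -
  have "\<exists>c0>0. s = 0 \<or> (\<forall>q\<ge>1. c0 \<le> real q powr (1 / s) * dist_int (real q * \<theta>))"
  proof (cases "s = 0")
    case True
    then show ?thesis by (auto intro: exI[of _ 1])
  next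
    case False
    define c0 where "c0 = (INF q\<in>{1::nat..}. real q powr (1 / s) * dist_int (real q * \<theta>))"
    have "c0 \<le> real q powr (1 / s) * dist_int (real q * \<theta>)" if "1 \<le> q" for q
      unfolding c0_def using that dist_int_nonneg
      by (intro cINF_lower) (auto intro!: bdd_belowI[of _ 0])
    then show ?thesis using assms(4) False by (auto simp: c0_def)
  qed
  then obtain c0 where c0: "0 < c0"
    "s = 0 \<or> (\<forall>q\<ge>1. c0 \<le> real q powr (1 / s) * dist_int (real q * \<theta>))" by blast
  have "ab_winning (1/2) \<beta> (Bad_fibre s t \<theta>)" if \<beta>: "0 < \<beta>" "\<beta> < 1" for \<beta>
  proof (cases "t = 0")
    \<comment> \<open>Here \<open>s = 1\<close> and \<theta> is badly approximable, so the first
      entry of the maximum alone puts every \<open>y\<close> into the fibre and any directions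
      win.\<close>
    case True
    then have "s = 1" using assms by simp
    have "y \<in> Bad_fibre s t \<theta>" for y
      by (rule Bad_fibreI[OF c0(1)]) (use c0(2) \<open>s = 1\<close> in \<open>auto intro: max.coboundedI1\<close>)
    then show ?thesis by (intro ab_winning_by_directions \<beta>)
  next
    case False
    then have t: "0 < t" using assms by simp
    define R where "R = (2 / \<beta>)\<^sup>2"
    define \<eta> where "\<eta> = \<beta> / (4 * R ^ 7)"
    have R: "1 < R" unfolding R_def using \<beta> by (intro one_less_power) auto
    have \<eta>: "0 < \<eta>" "\<eta> \<le> 1"
    proof -
      show "0 < \<eta>" using \<beta> R by (simp add: \<eta>_def)
      have "1 \<le> R ^ 7" using R by (intro one_le_power) auto
      then have "\<beta> \<le> 1 * (4 * R ^ 7)" using \<beta> by linarith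
      then show "\<eta> \<le> 1" unfolding \<eta>_def using R by (subst pos_divide_le_eq) auto
    qed
    obtain l K where Kl: "2 \<le> l" "l \<le> K"
      "\<forall>k\<ge>1. 96 * R ^ (k + l + 7 + 2) < \<eta> * (R ^ (K + l * (k - 1) - 1)) powr t"
      using exists_gap_exponent[OF R \<eta>(1) t, of 7] by metis
    \<comment> \<open>The constants depend on \<rho> because Bob chooses the initial radius. The
      bound \<open>c0\<close> passes the assumption on \<theta> to the lines.\<close>
    define c1 where "c1 \<rho> = min (min \<rho> c0) (1 / (6 * R ^ (K + 2)))" for \<rho>
    define c where "c \<rho> = \<eta> * c1 \<rho> / 4" for \<rho>
    define Z where "Z \<rho> = line_zones.zone s t \<theta> R (c \<rho>) (c1 \<rho>) \<rho> K l" for \<rho>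
    have zones: "line_zones s t \<theta> R (c \<rho>) (c1 \<rho>) \<rho> \<eta> K l 7" if \<rho>: "0 < \<rho>" for \<rho>
    proof
      show "0 < c1 \<rho>" using \<rho> c0 R by (simp add: c1_def)
      have "c1 \<rho> \<le> 1 / (6 * R ^ (K + 2))" by (simp add: c1_def)
      then show "6 * c1 \<rho> * R ^ (K + 2) \<le> 1" using R by (simp add: field_simps)
      show "c1 \<rho> \<le> \<rho>" by (simp add: c1_def)
      have "c \<rho> \<le> c1 \<rho>" using \<eta> \<open>0 < c1 \<rho>\<close> mult_right_mono[of \<eta> 4 "c1 \<rho>"] by (simp add: c_def)
      then have "c \<rho> \<le> c0" by (simp add: c1_def)
      show "s = 0 \<or> (\<forall>A C. A \<noteq> 0 \<longrightarrow> c \<rho> \<le> \<bar>real_of_int A\<bar> powr (1 / s) * \<bar>of_int A * \<theta> + of_int C\<bar>)"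
      proof (cases "s = 0")
        case False
        have "c \<rho> \<le> \<bar>real_of_int A\<bar> powr (1 / s) * \<bar>of_int A * \<theta> + of_int C\<bar>" if "A \<noteq> 0" for A C
        proof -
          define q where "q = nat \<bar>A\<bar>"
          have q: "real q = \<bar>real_of_int A\<bar>" "1 \<le> q" using that by (auto simp: q_def)
          have "c \<rho> \<le> real q powr (1 / s) * dist_int (real q * \<theta>)"
            using c0(2) False q \<open>c \<rho> \<le> c0\<close> by (meson order_trans)
          also have "\<dots> \<le> real q powr (1 / s) * \<bar>real q * \<theta> - of_int (- sgn A * C)\<bar>"
            by (intro mult_left_mono dist_int_le) auto
          also have "real q * \<theta> - of_int (- sgn A * C) = of_int (sgn A) * (of_int A * \<theta> + of_int C)"
            unfolding q(1) by (simp add: sgn_if abs_if algebra_simps)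
          also have "\<bar>\<dots>\<bar> = \<bar>of_int A * \<theta> + of_int C\<bar>"
            using that by (simp add: abs_mult sgn_if)
          finally show ?thesis by (simp add: q)
        qed
        then show ?thesis by blast
      qed simp
      show "c \<rho> = \<eta> * c1 \<rho> / 4" by (rule c_def)
      show "96 * R ^ (k + l + 7 + 2) < \<eta> * (R ^ (K + l * (k - 1) - 1)) powr t" if "1 \<le> k" for k
        using Kl(3) that by simp
    qed (fact assms(1,3) t R \<eta> \<rho> Kl(1,2))+
    show ?thesis
    proof (rule ab_winning_by_covering[OF \<beta> R_def \<eta>_def])
      fix \<rho> :: real and j k :: nat and I :: "real \<times> real"
      assume \<rho>: "0 < \<rho>" and I: "snd I = \<rho> / R ^ j"
        and avoid: "\<And>n k'. \<lbrakk>2 * k' \<le> n; n + 7 \<le> j\<rbrakk> \<Longrightarrow> ball_of I \<inter> Z \<rho> n k' = {}"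
      show "\<exists>y. Z \<rho> (j + k) k \<inter> ball_of I \<subseteq> cball y (\<eta> * \<rho> / R ^ (j + k))"
        using line_zones.zone_cover[OF zones[OF \<rho>] I] avoid unfolding Z_def by blast
    next
      fix \<rho> x :: real
      assume \<rho>: "0 < \<rho>" and x: "\<And>n k. 2 * k \<le> n \<Longrightarrow> x \<notin> Z \<rho> n k"
      interpret line_zones s t \<theta> R "c \<rho>" "c1 \<rho>" \<rho> \<eta> K l 7 by (rule zones[OF \<rho>])
      show "x \<in> Bad_fibre s t \<theta>"
      proof (rule Bad_fibreI[OF c_pos], rule ccontr)
        fix q :: nat
        assume q: "1 \<le> q" and "\<not> c \<rho> \<le> max (real q powr s * dist_int (real q * \<theta>)) (real q powr t * dist_int (real q * x))"
        then have "dist_int (real q * \<theta>) < c \<rho> / real q powr s" "dist_int (real q * x) < c \<rho> / real q powr t"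
          by (auto simp: field_simps not_le)
        then obtain p r where "\<bar>real q * \<theta> - of_int p\<bar> < c \<rho> / real q powr s" "\<bar>real q * x - of_int r\<bar> < c \<rho> / real q powr t"
          by (meson dist_int_lessE)
        then have "point x p r (int q)" using q by (simp add: point_def field_simps)
        then show False using zone_ex x unfolding Z_def by blast
      qed
    qed
  qed
  then show ?thesis by (simp add: alpha_winning_def)
qed

end
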